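(* Let $G$ be a Polish group with ample generic elements. Then $G$ is not the union of countably many non-open subgroups; more generally, $G$ is not the union of countably many cosets $g_iH_i$ ($i\in\mathbb N$, $g_i\in G$) of non-open subgroups $H_i\leq G$.
   Context: A Polish group $G$ has ample generic elements if for each finite $n\ge 1$ there is a comeager orbit for the diagonal conjugacy action of $G$ on $G^n$, $g\cdot(g_1,\dots,g_n)=(gg_1g^{-1},\dots,gg_ng^{-1})$. *)

theory Defs
  imports "HOL-Analysis.Analysis" "HOL-Algebra.Group_Action"
begin

locale topological_group = group G for G (structure) +
  fixes T :: "'a topology"
  assumes topspace_eq_carrier: "topspace T = carrier G"
    and continuous_mult: "continuous_map (prod_topology T T) T (\<lambda>(x, y). x \<otimes> y)"
    and continuous_inv: "continuous_map T T (\<lambda>x. inv x)"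

locale polish_group = topological_group +
  assumes completely_metrizable: "completely_metrizable_space T"
    and separable: "separable_space T"

definition nowhere_dense_in :: "'a topology \<Rightarrow> 'a set \<Rightarrow> bool" where
  "nowhere_dense_in X N \<longleftrightarrow>
     N \<subseteq> topspace X \<and> X interior_of (Abstract_Topology.closure_of X N) = {}"

definition meager_in :: "'a topology \<Rightarrow> 'a set \<Rightarrow> bool" where
  "meager_in X S \<longleftrightarrow>
     (\<exists>\<N>. countable \<N> \<and> (\<forall>N\<in>\<N>. nowhere_dense_in X N) \<and> S = \<Union>\<N>)"

definition comeager_in :: "'a topology \<Rightarrow> 'a set \<Rightarrow> bool" where
  "comeager_in X S \<longleftrightarrow> S \<subseteq> topspace X \<and> meager_in X (topspace X - S)"

text \<open>An element of the power \<open>G\<^sup>n\<close> is an extensional function on the index set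
  \<open>{..<n}\<close>; the power carries the product topology.\<close>

definition power_topology :: "'a topology \<Rightarrow> nat \<Rightarrow> (nat \<Rightarrow> 'a) topology" where
  "power_topology T n = product_topology (\<lambda>_. T) {..<n}"

definition diag_conj ::
  "('a, 'b) monoid_scheme \<Rightarrow> nat \<Rightarrow> 'a \<Rightarrow> (nat \<Rightarrow> 'a) \<Rightarrow> (nat \<Rightarrow> 'a)" where
  "diag_conj G n g x = (\<lambda>i\<in>{..<n}. g \<otimes>\<^bsub>G\<^esub> x i \<otimes>\<^bsub>G\<^esub> inv\<^bsub>G\<^esub> g)"

definition ample_generics :: "('a, 'b) monoid_scheme \<Rightarrow> 'a topology \<Rightarrow> bool" where
  "ample_generics G T \<longleftrightarrow>
     (\<forall>n\<ge>1. \<exists>x \<in> topspace (power_topology T n).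
        comeager_in (power_topology T n) (orbit G (diag_conj G n) x))"

end

theory Submission
  imports Defs
begin

text \<open>
  Suppose that \<open>G\<close> is covered by cosets \<open>k\<^sub>i H\<^sub>i\<close> of non-open subgroups. The meager \<open>H\<^sub>i\<close> account
  only for a meager set, which misses an intersection of dense open sets \<open>D\<^sub>i\<close>. A point of all the
  \<open>D\<^sub>i\<close> that lies in no \<open>k\<^sub>i H\<^sub>i\<close> with \<open>H\<^sub>i\<close> non-meager is the limit of a sequence of choices.

  The state of the construction is a generic tuple \<open>x\<close>, that is, one with a comeager conjugacy
  orbit, and an element \<open>h\<close>. The limit is sought in the closed set \<open>{c. c \<cdot> x = h \<cdot> x}\<close>, the
  coset of the centralizer of \<open>x\<close> that contains \<open>h\<close>. To escape from \<open>k H\<close>, where \<open>H\<close> is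
  non-meager and not open, take \<open>a \<in> H\<close> and \<open>b \<notin> H\<close> such that both \<open>(x, a)\<close> and \<open>(x, b)\<close> are generic, and \<open>v\<close> near \<open>\<one>\<close> that commutes with
  \<open>x\<close> and conjugates \<open>b\<close> to \<open>a\<close>. Replace \<open>(x, h)\<close> by either \<open>((x, a), h)\<close> or \<open>((x, b), h v)\<close>; both
  centralizer cosets are contained in the previous one. If \<open>c\<close> in the first coset and \<open>e\<close> in the second one were both in
  \<open>k H\<close>, then \<open>e\<inverse> c\<close> would be an element of \<open>H\<close> that conjugates \<open>a\<close> to \<open>b\<close>,
  contradicting \<open>b \<notin> H\<close>. So one of the two cosets is disjoint from \<open>k H\<close>, and this choice can never be spoiled later
  (\<open>transporters_not_both_meet_coset\<close>).

  Three facts provide \<open>a\<close>, \<open>b\<close> and \<open>v\<close> (\<open>exists_separating_generic_extensions\<close>). By the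
  Kuratowski-Ulam theorem, comeagerly many \<open>y\<close> extend a generic \<open>x\<close> to a generic \<open>(x, y)\<close>
  (\<open>comeager_generic_extensions\<close>), so a non-meager \<open>H\<close> contains such an \<open>a\<close>. By Pettis' argument the
  complement of a non-open subgroup is non-meager in every non-empty open set, so \<open>b\<close> can be found as close
  to \<open>a\<close> as required. By a theorem of Effros type a comeager orbit carries the quotient topology of
  the group, so that the conjugating element can be taken near \<open>\<one>\<close>
  (\<open>comeager_orbit_locally_transitive\<close>).

  It remains to stay inside the \<open>D\<^sub>i\<close>. All states that the construction might ever visit form a
  countable set, if the neighbourhoods of \<open>\<one>\<close> come from a countable base. Hence a single left
  translation by some \<open>w\<close> moves every \<open>h\<close> that occurs into every \<open>D\<^sub>i\<close>. After this translation,
  which turns left cosets into left cosets, a small closed ball around \<open>w h\<close> fits into the required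
  \<open>D\<^sub>i\<close> at each stage, and the nested closed sets have a common point by completeness.
\<close>

(* This frees closure_of for the topological closure. *)
no_notation eq_closure_of (\<open>closure'_of\<index>\<close>)

section \<open>Category in topological spaces\<close>

lemma meager_in_subset:
  assumes "meager_in X S" "T \<subseteq> S"
  shows "meager_in X T"
proof -
  obtain \<N> where N: "countable \<N>" "\<And>N. N \<in> \<N> \<Longrightarrow> nowhere_dense_in X N" "S = \<Union>\<N>"
    using assms(1) unfolding meager_in_def by blast
  have "nowhere_dense_in X (N \<inter> T)" if "N \<in> \<N>" for N
  proof -
    have "X interior_of (X closure_of (N \<inter> T)) \<subseteq> X interior_of (X closure_of N)"
      by (intro interior_of_mono closure_of_mono) auto
    then show ?thesis using N(2)[OF that] unfolding nowhere_dense_in_def by auto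
  qed
  moreover have "T = \<Union>((\<lambda>N. N \<inter> T) ` \<N>)" using assms(2) N(3) by auto
  ultimately show ?thesis unfolding meager_in_def
    using N(1) by (intro exI[of _ "(\<lambda>N. N \<inter> T) ` \<N>"]) auto
qed

lemma meager_in_UN:
  assumes "countable I" "\<And>i. i \<in> I \<Longrightarrow> meager_in X (S i)"
  shows "meager_in X (\<Union>i\<in>I. S i)"
proof -
  have "\<forall>i\<in>I. \<exists>\<N>. countable \<N> \<and> (\<forall>N\<in>\<N>. nowhere_dense_in X N) \<and> S i = \<Union>\<N>"
    using assms(2) unfolding meager_in_def by blast
  then obtain \<N> where N: "\<And>i. i \<in> I \<Longrightarrow> countable (\<N> i)"
    "\<And>i N. i \<in> I \<Longrightarrow> N \<in> \<N> i \<Longrightarrow> nowhere_dense_in X N" "\<And>i. i \<in> I \<Longrightarrow> S i = \<Union>(\<N> i)"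
    by metis
  show ?thesis unfolding meager_in_def
    by (rule exI[of _ "\<Union>i\<in>I. \<N> i"]) (use assms(1) N in auto)
qed

lemma meager_in_Un:
  assumes "meager_in X S" "meager_in X T"
  shows "meager_in X (S \<union> T)"
proof -
  have "S \<union> T = (\<Union>b\<in>UNIV. if b then S else T)" by (auto split: if_splits)
  then show ?thesis using assms meager_in_UN[of UNIV X "\<lambda>b. if b then S else T"] by simp
qed

lemma meager_in_homeomorphic_image:
  assumes "homeomorphic_map X Y f" "meager_in X S"
  shows "meager_in Y (f ` S)"
proof -
  obtain \<N> where N: "countable \<N>" "\<And>N. N \<in> \<N> \<Longrightarrow> nowhere_dense_in X N" "S = \<Union>\<N>"
    using assms(2) unfolding meager_in_def by blast
  have "nowhere_dense_in Y (f ` N)" if "N \<in> \<N>" for N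
  proof -
    have *: "N \<subseteq> topspace X" "X interior_of (X closure_of N) = {}"
      using N(2)[OF that] unfolding nowhere_dense_in_def by auto
    then have "Y interior_of (Y closure_of (f ` N)) = {}"
      by (simp add: homeomorphic_map_closure_of[OF assms(1)]
          homeomorphic_map_interior_of[OF assms(1)] closure_of_subset_topspace)
    moreover have "f ` N \<subseteq> topspace Y"
      using *(1) homeomorphic_imp_surjective_map[OF assms(1)] by auto
    ultimately show ?thesis unfolding nowhere_dense_in_def by simp
  qed
  moreover have "f ` S = \<Union>((`) f ` \<N>)" using N(3) by auto
  ultimately show ?thesis unfolding meager_in_def
    using N(1) by (intro exI[of _ "(`) f ` \<N>"]) auto
qed

lemma openin_subset_meager_empty:
  assumes "completely_metrizable_space X" "meager_in X S" "openin X U" "U \<subseteq> S"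
  shows "U = {}"
proof -
  obtain \<N> where N: "countable \<N>" "\<And>N. N \<in> \<N> \<Longrightarrow> nowhere_dense_in X N" "S = \<Union>\<N>"
    using assms(2) unfolding meager_in_def by blast
  have "X interior_of \<Union>((closure_of) X ` \<N>) = {}"
    by (rule Baire_category_alt) (use assms(1) N in \<open>auto simp: nowhere_dense_in_def\<close>)
  moreover have "N \<subseteq> X closure_of N" if "N \<in> \<N>" for N
    using N(2)[OF that] closure_of_subset unfolding nowhere_dense_in_def by metis
  then have "U \<subseteq> \<Union>((closure_of) X ` \<N>)"
    using assms(4) unfolding N(3) by blast
  ultimately show ?thesis using assms(3) interior_of_eq_empty by metis
qed

lemma comeager_in_superset:
  assumes "comeager_in X S" "S \<subseteq> T" "T \<subseteq> topspace X"
  shows "comeager_in X T"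
  using assms meager_in_subset[of X "topspace X - S" "topspace X - T"]
  unfolding comeager_in_def by blast

lemma comeager_in_INT:
  assumes "countable I" "I \<noteq> {}" "\<And>i. i \<in> I \<Longrightarrow> comeager_in X (S i)"
  shows "comeager_in X (\<Inter>i\<in>I. S i)"
proof -
  have "topspace X - (\<Inter>i\<in>I. S i) = (\<Union>i\<in>I. topspace X - S i)" by auto
  moreover have "meager_in X (\<Union>i\<in>I. topspace X - S i)"
    using assms by (intro meager_in_UN) (auto simp: comeager_in_def)
  ultimately show ?thesis using assms unfolding comeager_in_def by auto
qed

lemma comeager_in_dense_open:
  assumes "openin X D" "X closure_of D = topspace X"
  shows "comeager_in X D"
proof -
  have "nowhere_dense_in X (topspace X - D)" unfolding nowhere_dense_in_def
    using assms by (simp add: closure_of_complement interior_of_openin interior_of_complement)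
  then have "meager_in X (topspace X - D)" unfolding meager_in_def
    by (intro exI[of _ "{topspace X - D}"]) auto
  then show ?thesis using openin_subset[OF assms(1)] unfolding comeager_in_def by simp
qed

lemma comeager_in_obtain_dense_open:
  assumes "comeager_in X S"
  obtains D :: "nat \<Rightarrow> 'a set" where "\<And>n. openin X (D n)" "\<And>n. X closure_of (D n) = topspace X"
    "(\<Inter>n. D n) \<subseteq> S"
proof -
  have "meager_in X (topspace X - S)" using assms unfolding comeager_in_def by simp
  then obtain \<N> where
    "countable \<N> \<and> (\<forall>N\<in>\<N>. nowhere_dense_in X N) \<and> topspace X - S = \<Union>\<N>"
    unfolding meager_in_def ..
  then have N: "countable \<N>" "\<And>N. N \<in> \<N> \<Longrightarrow> nowhere_dense_in X N" "topspace X - S = \<Union>\<N>"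
    by simp_all
  define \<D> where "\<D> = insert (topspace X) ((\<lambda>N. topspace X - X closure_of N) ` \<N>)"
  have \<D>: "countable \<D>" "\<D> \<noteq> {}" using N(1) unfolding \<D>_def by auto
  have 1: "openin X D \<and> X closure_of D = topspace X" if "D \<in> \<D>" for D
    using that N(2) unfolding \<D>_def nowhere_dense_in_def
    by (auto simp: closure_of_complement closure_of_topspace)
  have 2: "\<Inter>\<D> \<subseteq> S"
  proof
    fix x assume x: "x \<in> \<Inter>\<D>"
    then have "x \<in> topspace X" unfolding \<D>_def by auto
    moreover have "x \<notin> N" if "N \<in> \<N>" for N
    proof -
      have "N \<subseteq> X closure_of N"
        using N(2)[OF that] closure_of_subset unfolding nowhere_dense_in_def by blast
      moreover have "x \<in> topspace X - X closure_of N" using x that unfolding \<D>_def by blast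
      ultimately show ?thesis by blast
    qed
    ultimately show "x \<in> S" using N(3) by auto
  qed
  show ?thesis
  proof (rule that[of "from_nat_into \<D>"])
    show "(\<Inter>n. from_nat_into \<D> n) \<subseteq> S" using 2 range_from_nat_into[OF \<D>(2,1)] by simp
  qed (use 1 from_nat_into[OF \<D>(2)] in auto)
qed

lemma comeager_in_nonempty:
  assumes "completely_metrizable_space X" "topspace X \<noteq> {}" "comeager_in X S"
  shows "S \<noteq> {}"
  using openin_subset_meager_empty[OF assms(1), of "topspace X" "topspace X"] assms(2,3)
  unfolding comeager_in_def by auto

lemma comeager_in_homeomorphic_image:
  assumes f: "homeomorphic_map X Y f" and S: "comeager_in X S"
  shows "comeager_in Y (f ` S)"
proof -
  have S': "S \<subseteq> topspace X" "meager_in Y (f ` (topspace X - S))"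
    using S meager_in_homeomorphic_image[OF f] unfolding comeager_in_def by simp_all
  have "f ` (topspace X - S) = f ` topspace X - f ` S"
    using S'(1) homeomorphic_imp_injective_map[OF f]
    by (intro inj_on_image_set_diff[where C = "topspace X"]) auto
  moreover have Y: "f ` topspace X = topspace Y" by (rule homeomorphic_imp_surjective_map[OF f])
  moreover have "f ` S \<subseteq> topspace Y" using image_mono[OF S'(1), of f] Y by simp
  ultimately show ?thesis using S'(2) unfolding comeager_in_def by simp
qed

lemma not_meager_meets_comeager:
  assumes "comeager_in X S" "\<not> meager_in X A" "A \<subseteq> topspace X"
  shows "A \<inter> S \<noteq> {}"
  using assms meager_in_subset[of X "topspace X - S" A] unfolding comeager_in_def by blast

lemma separable_metrizable_countable_base:
  assumes "metrizable_space X" "separable_space X"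
  obtains \<B> where "countable \<B>" "\<And>B. B \<in> \<B> \<Longrightarrow> openin X B \<and> B \<noteq> {}"
    "\<And>U x. openin X U \<Longrightarrow> x \<in> U \<Longrightarrow> \<exists>B\<in>\<B>. x \<in> B \<and> B \<subseteq> U"
proof -
  obtain M d where M: "Metric_space M d" "X = Metric_space.mtopology M d"
    using assms(1) unfolding metrizable_space_def by blast
  interpret Metric_space M d by fact
  obtain C where C: "countable C" "C \<subseteq> M" "mtopology closure_of C = M"
    using assms(2) M(2) unfolding separable_space_def by auto
  define \<B> where "\<B> = (\<lambda>(c, n::nat). mball c (inverse (Suc n))) ` (C \<times> UNIV)"
  show ?thesis
  proof (rule that[of \<B>])
    show "countable \<B>" unfolding \<B>_def using C(1) by auto
    show "openin X B \<and> B \<noteq> {}" if B: "B \<in> \<B>" for B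
    proof -
      obtain c n where "c \<in> C" "B = mball c (inverse (real (Suc n)))"
        using B unfolding \<B>_def by (auto simp del: of_nat_Suc)
      then show ?thesis using C(2) M(2) mball_eq_empty[of c "inverse (real (Suc n))"] by auto
    qed
    fix U x assume U: "openin X U" "x \<in> U"
    then obtain r where r: "r > 0" "mball x r \<subseteq> U" "x \<in> M"
      using M(2) openin_mtopology by (metis subsetD)
    obtain n where n: "inverse (real (Suc n)) < r / 2" using r(1) reals_Archimedean[of "r/2"] by auto
    define e where "e = inverse (real (Suc n))"
    have e: "e > 0" "e < r / 2" using n unfolding e_def by auto
    have "C \<inter> mball x e \<noteq> {}"
      using C(3) r(3) e(1) dense_intersects_open[of mtopology C] by (simp add: mball_eq_empty)
    then obtain c where c: "c \<in> C" "c \<in> M" "d x c < e" by auto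
    have "mball c e \<subseteq> mball x r"
      by (rule mball_subset) (use e c r commute[of c x] in auto)
    moreover have "x \<in> mball c e" using c r(3) commute[of c x] by auto
    moreover have "mball c e \<in> \<B>" using c(1) unfolding \<B>_def e_def by force
    ultimately show "\<exists>B\<in>\<B>. x \<in> B \<and> B \<subseteq> U"
      using r(2) by blast
  qed
qed

section \<open>Sections of comeager sets\<close>

lemma topspace_power_topology: "topspace (power_topology T n) = (\<Pi>\<^sub>E i\<in>{..<n}. topspace T)"
  unfolding power_topology_def by simp

lemma power_topology_update:
  "x \<in> topspace (power_topology T n) \<Longrightarrow> y \<in> topspace T \<Longrightarrow>
     x(n := y) \<in> topspace (power_topology T (Suc n))"
  unfolding topspace_power_topology lessThan_Suc by (rule PiE_fun_upd) auto

lemma continuous_map_power_topology: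
  "continuous_map X (power_topology T n) f \<longleftrightarrow>
     f ` topspace X \<subseteq> extensional {..<n} \<and> (\<forall>i<n. continuous_map X T (\<lambda>x. f x i))"
  unfolding power_topology_def by (auto simp: continuous_map_componentwise)

lemma continuous_map_power_projection:
  "i < n \<Longrightarrow> continuous_map (power_topology T n) T (\<lambda>x. x i)"
  unfolding power_topology_def by (rule continuous_map_product_projection) simp

lemma continuous_map_power_update_left:
  assumes "y \<in> topspace T"
  shows "continuous_map (power_topology T n) (power_topology T (Suc n)) (\<lambda>x. x(n := y))"
  unfolding continuous_map_power_topology
proof (intro conjI allI impI)
  show "(\<lambda>x. x(n := y)) ` topspace (power_topology T n) \<subseteq> extensional {..<Suc n}"
    using power_topology_update[OF _ assms] unfolding topspace_power_topology PiE_def by blast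
  fix i assume "i < Suc n"
  then show "continuous_map (power_topology T n) T (\<lambda>x. (x(n := y)) i)"
    using assms continuous_map_power_projection[of i n T] by (cases "i = n") auto
qed

lemma continuous_map_power_update_right:
  assumes "x \<in> topspace (power_topology T n)"
  shows "continuous_map T (power_topology T (Suc n)) (\<lambda>y. x(n := y))"
  unfolding continuous_map_power_topology
proof (intro conjI allI impI)
  show "(\<lambda>y. x(n := y)) ` topspace T \<subseteq> extensional {..<Suc n}"
    using power_topology_update[OF assms] unfolding topspace_power_topology PiE_def by blast
  fix i assume i: "i < Suc n"
  show "continuous_map T T (\<lambda>y. (x(n := y)) i)"
  proof (cases "i = n")
    case True
    then show ?thesis by simp
  next
    case False
    then have "x i \<in> topspace T"
      using assms i PiE_mem[of x "{..<n}" "\<lambda>_. topspace T" i] by (simp add: topspace_power_topology)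
    then show ?thesis using False by simp
  qed
qed

lemma continuous_map_power_restrict:
  "continuous_map (power_topology T (Suc n)) (power_topology T n) (\<lambda>z. restrict z {..<n})"
  unfolding continuous_map_power_topology
  by (auto simp: continuous_map_power_projection)

text \<open>
  One half of the Kuratowski-Ulam theorem. For dense open \<open>D\<close> and \<open>B\<close> in a countable base, the tuples
  \<open>x\<close> whose section of \<open>D\<close> meets \<open>B\<close> form a dense open set; a tuple that belongs to all these sets
  has a dense open section.
\<close>
lemma comeager_in_power_sections:
  assumes T: "metrizable_space T" "separable_space T"
    and S: "comeager_in (power_topology T (Suc n)) S"
  shows "comeager_in (power_topology T n)
           {x \<in> topspace (power_topology T n). comeager_in T {y \<in> topspace T. x(n := y) \<in> S}}"
proof -
  let ?X = "power_topology T n" and ?X' = "power_topology T (Suc n)"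
  obtain \<B> where B: "countable \<B>" "\<And>B. B \<in> \<B> \<Longrightarrow> openin T B \<and> B \<noteq> {}"
    "\<And>U x. openin T U \<Longrightarrow> x \<in> U \<Longrightarrow> \<exists>B\<in>\<B>. x \<in> B \<and> B \<subseteq> U"
    using separable_metrizable_countable_base[OF T] by metis
  obtain D :: "nat \<Rightarrow> (nat \<Rightarrow> 'a) set" where D: "\<And>k. openin ?X' (D k)"
    "\<And>k. ?X' closure_of (D k) = topspace ?X'" "(\<Inter>k. D k) \<subseteq> S"
    using comeager_in_obtain_dense_open[OF S] by metis
  define P where "P k B = {x \<in> topspace ?X. \<exists>y\<in>B. x(n := y) \<in> D k}" for k B
  have P: "comeager_in ?X (P k B)" if B0: "B \<in> \<B>" for k B
  proof (rule comeager_in_dense_open)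
    have eq: "P k B = (\<Union>y\<in>B. {x \<in> topspace ?X. x(n := y) \<in> D k})"
      unfolding P_def by auto
    show "openin ?X (P k B)" unfolding eq
    proof (rule openin_Union, clarify)
      fix y assume "y \<in> B"
      then have y: "y \<in> topspace T" using B(2)[OF B0] openin_subset by blast
      show "openin ?X {x \<in> topspace ?X. x(n := y) \<in> D k}"
        by (rule openin_continuous_map_preimage[OF continuous_map_power_update_left[OF y] D(1)])
    qed
    show "?X closure_of (P k B) = topspace ?X" unfolding dense_intersects_open
    proof (intro allI impI, elim conjE)
      fix U assume U: "openin ?X U" "U \<noteq> {}"
      define W where "W = {z \<in> topspace ?X'. restrict z {..<n} \<in> U} \<inter> {z \<in> topspace ?X'. z n \<in> B}"
      have "openin ?X' W" unfolding W_def
        using U(1) B(2)[OF B0] continuous_map_power_projection[of n "Suc n" T]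
        by (intro openin_Int openin_continuous_map_preimage[OF continuous_map_power_restrict]
            openin_continuous_map_preimage[where Y = T]) auto
      moreover have "W \<noteq> {}"
      proof -
        obtain x y where xy: "x \<in> U" "y \<in> B" using U(2) B(2)[OF B0] by auto
        then have *: "x \<in> topspace ?X" "y \<in> topspace T"
          using U(1) B(2)[OF B0] openin_subset by blast+
        have "restrict (x(n := y)) {..<n} = x"
          using *(1) unfolding topspace_power_topology by (auto simp: fun_eq_iff PiE_def extensional_def)
        then have "x(n := y) \<in> W" unfolding W_def using xy power_topology_update[OF *] by auto
        then show ?thesis by auto
      qed
      ultimately obtain z where z: "z \<in> D k" "z \<in> W"
        using D(2)[of k] dense_intersects_open[of ?X' "D k"] by blast
      have "(restrict z {..<n})(n := z n) = z"
        using z(2) unfolding W_def topspace_power_topology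
        by (auto simp: fun_eq_iff PiE_def extensional_def)
      then have "restrict z {..<n} \<in> P k B \<inter> U"
        using z openin_subset[OF U(1)] unfolding W_def P_def by force
      then show "P k B \<inter> U \<noteq> {}" by auto
    qed
  qed
  show ?thesis
  proof (cases "\<B> = {}")
    case True
    \<comment> \<open>An empty base means that the space is empty, and then every section is empty.\<close>
    then have "topspace T = {}" using B(3)[OF openin_topspace] by blast
    then have "comeager_in T {y \<in> topspace T. x(n := y) \<in> S}" for x
      using comeager_in_dense_open[of T "{}"] by simp
    then show ?thesis using comeager_in_dense_open[of ?X "topspace ?X"] by simp
  next
    case False
    then have "comeager_in ?X (\<Inter>(k, B)\<in>UNIV \<times> \<B>. P k B)"
      using B(1) P by (intro comeager_in_INT) auto
    then show ?thesis
    proof (rule comeager_in_superset)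
      show "(\<Inter>(k, B)\<in>UNIV \<times> \<B>. P k B) \<subseteq>
          {x \<in> topspace ?X. comeager_in T {y \<in> topspace T. x(n := y) \<in> S}}"
      proof (intro subsetI CollectI conjI)
        fix x assume x: "x \<in> (\<Inter>(k, B)\<in>UNIV \<times> \<B>. P k B)"
        then show xX: "x \<in> topspace ?X" using False unfolding P_def by auto
        have "comeager_in T {y \<in> topspace T. x(n := y) \<in> D k}" for k
        proof (rule comeager_in_dense_open)
          show "openin T {y \<in> topspace T. x(n := y) \<in> D k}"
            using openin_continuous_map_preimage[OF continuous_map_power_update_right[OF xX] D(1)] .
          show "T closure_of {y \<in> topspace T. x(n := y) \<in> D k} = topspace T"
            unfolding dense_intersects_open
          proof (intro allI impI, elim conjE)
            fix U assume U: "openin T U" "U \<noteq> {}"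
            then obtain B' where "B' \<in> \<B>" "B' \<subseteq> U" using B(3) by blast
            moreover from this have "x \<in> P k B'" using x by auto
            ultimately show "{y \<in> topspace T. x(n := y) \<in> D k} \<inter> U \<noteq> {}"
              using openin_subset[OF U(1)] unfolding P_def by auto
          qed
        qed
        then have "comeager_in T (\<Inter>k. {y \<in> topspace T. x(n := y) \<in> D k})"
          by (intro comeager_in_INT) auto
        then show "comeager_in T {y \<in> topspace T. x(n := y) \<in> S}"
          by (rule comeager_in_superset) (use D(3) in auto)
      qed
    qed auto
  qed
qed

section \<open>Topological groups\<close>

context topological_group
begin

lemma continuous_map_mult [continuous_intros]:
  assumes "continuous_map Z T f" "continuous_map Z T h"
  shows "continuous_map Z T (\<lambda>z. f z \<otimes> h z)"
  using continuous_map_compose[OF continuous_map_pairedI[OF assms] continuous_mult]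
  by (simp add: o_def)

lemma continuous_map_inv [continuous_intros]:
  "continuous_map Z T f \<Longrightarrow> continuous_map Z T (\<lambda>z. inv (f z))"
  using continuous_map_compose[OF _ continuous_inv] by (simp add: o_def)

lemma continuous_map_const_carrier [continuous_intros]:
  "a \<in> carrier G \<Longrightarrow> continuous_map Z T (\<lambda>z. a)"
  by (simp add: topspace_eq_carrier)

lemma openin_carrier: "openin T U \<Longrightarrow> U \<subseteq> carrier G"
  using openin_subset topspace_eq_carrier by metis

lemma homeomorphic_map_left_mult:
  assumes "a \<in> carrier G"
  shows "homeomorphic_map T T (\<lambda>x. a \<otimes> x)"
proof -
  have "continuous_map T T (\<lambda>x. a \<otimes> x)" "continuous_map T T (\<lambda>x. inv a \<otimes> x)"
    using assms by (auto intro!: continuous_intros simp: continuous_map_id[unfolded id_def])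
  then have "homeomorphic_maps T T (\<lambda>x. a \<otimes> x) (\<lambda>x. inv a \<otimes> x)"
    unfolding homeomorphic_maps_def topspace_eq_carrier using assms
    by (simp add: m_assoc[symmetric])
  then show ?thesis using homeomorphic_maps_map by blast
qed

lemma openin_left_mult_preimage:
  assumes "openin T U" "a \<in> carrier G"
  shows "openin T {x \<in> carrier G. a \<otimes> x \<in> U}"
  using openin_continuous_map_preimage[OF
      homeomorphic_imp_continuous_map[OF homeomorphic_map_left_mult[OF assms(2)]] assms(1)]
  by (simp add: topspace_eq_carrier)

lemma openin_right_mult_preimage:
  assumes "openin T U" "a \<in> carrier G"
  shows "openin T {x \<in> carrier G. x \<otimes> a \<in> U}"
proof -
  have "continuous_map T T (\<lambda>x. x \<otimes> a)"
    using assms(2) by (auto intro!: continuous_intros simp: continuous_map_id[unfolded id_def])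
  from openin_continuous_map_preimage[OF this assms(1)] show ?thesis
    by (simp add: topspace_eq_carrier)
qed

lemma openin_inv_preimage:
  assumes "openin T U"
  shows "openin T {x \<in> carrier G. inv x \<in> U}"
  using openin_continuous_map_preimage[OF continuous_inv assms] by (simp add: topspace_eq_carrier)

text \<open>
  Continuity of \<open>(a, b) \<mapsto> a\<inverse> b g\<close> at \<open>(\<one>, \<one>)\<close>, in the form in which it is used to shrink
  neighbourhoods.
\<close>
lemma inv_mult_neighbourhood:
  assumes "openin T U" "g \<in> U"
  obtains N where "openin T N" "\<one> \<in> N" "\<And>a b. a \<in> N \<Longrightarrow> b \<in> N \<Longrightarrow> inv a \<otimes> b \<otimes> g \<in> U"
proof -
  have g: "g \<in> carrier G" using assms openin_carrier by blast
  let ?f = "\<lambda>p. inv (fst p) \<otimes> snd p \<otimes> g"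
  have "continuous_map (prod_topology T T) T ?f"
    using g by (intro continuous_intros) auto
  from openin_continuous_map_preimage[OF this assms(1)]
  have "openin (prod_topology T T) {p \<in> carrier G \<times> carrier G. ?f p \<in> U}"
    by (simp add: topspace_eq_carrier)
  moreover have "(\<one>, \<one>) \<in> {p \<in> carrier G \<times> carrier G. ?f p \<in> U}" using g assms(2) by simp
  ultimately have "\<exists>A B. openin T A \<and> openin T B \<and> \<one> \<in> A \<and> \<one> \<in> B \<and>
    A \<times> B \<subseteq> {p \<in> carrier G \<times> carrier G. ?f p \<in> U}"
    unfolding openin_prod_topology_alt by blast
  then obtain A B where AB: "openin T A" "openin T B" "\<one> \<in> A" "\<one> \<in> B"
    "A \<times> B \<subseteq> {p \<in> carrier G \<times> carrier G. ?f p \<in> U}"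
    by blast
  show ?thesis by (rule that[of "A \<inter> B"]) (use AB in auto)
qed

lemma homeomorphic_map_right_mult:
  assumes "a \<in> carrier G"
  shows "homeomorphic_map T T (\<lambda>x. x \<otimes> a)"
proof -
  have "continuous_map T T (\<lambda>x. x \<otimes> a)" "continuous_map T T (\<lambda>x. x \<otimes> inv a)"
    using assms by (auto intro!: continuous_intros simp: continuous_map_id[unfolded id_def])
  then have "homeomorphic_maps T T (\<lambda>x. x \<otimes> a) (\<lambda>x. x \<otimes> inv a)"
    unfolding homeomorphic_maps_def topspace_eq_carrier using assms
    by (simp add: m_assoc)
  then show ?thesis using homeomorphic_maps_map by blast
qed

lemma homeomorphic_map_conjugation:
  assumes "a \<in> carrier G"
  shows "homeomorphic_map T T (\<lambda>x. a \<otimes> x \<otimes> inv a)"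
  using homeomorphic_map_compose[OF homeomorphic_map_left_mult homeomorphic_map_right_mult,
      of a "inv a"] assms by (simp add: o_def)

lemma meager_in_left_coset:
  assumes "a \<in> carrier G" "meager_in T H"
  shows "meager_in T (a <# H)"
proof -
  have "a <# H = (\<lambda>x. a \<otimes> x) ` H" unfolding l_coset_def by auto
  then show ?thesis
    using meager_in_homeomorphic_image[OF homeomorphic_map_left_mult[OF assms(1)] assms(2)] by simp
qed

lemma openin_subgroup:
  assumes H: "subgroup H G" and V: "openin T V" "\<one> \<in> V" "V \<subseteq> H"
  shows "openin T H"
proof (subst openin_subopen, intro ballI)
  fix h assume h: "h \<in> H"
  then have hG: "h \<in> carrier G" using H subgroup.mem_carrier by metis
  let ?U = "{x \<in> carrier G. inv h \<otimes> x \<in> V}"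
  have "openin T ?U" using openin_left_mult_preimage[OF V(1)] hG by simp
  moreover have "h \<in> ?U" using hG V(2) by simp
  moreover have "?U \<subseteq> H"
  proof
    fix x assume x: "x \<in> ?U"
    then have "inv h \<otimes> x \<in> H" using V(3) by auto
    then have "h \<otimes> (inv h \<otimes> x) \<in> H" using subgroup.m_closed[OF H h] by simp
    then show "x \<in> H" using x hG by (simp add: m_assoc[symmetric])
  qed
  ultimately show "\<exists>U. openin T U \<and> h \<in> U \<and> U \<subseteq> H" by blast
qed

end

text \<open>
  Pettis' argument. If \<open>H\<close> is comeager in \<open>U\<close> and \<open>v\<close> is so close to \<open>\<one>\<close> that \<open>U \<inter> v U\<close> is
  non-empty, then \<open>H\<close> and \<open>v H\<close> are both comeager in this open set and hence meet, so \<open>v \<in> H\<close>. Thus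
  \<open>H\<close> contains a neighbourhood of \<open>\<one>\<close>.
\<close>
lemma (in polish_group) non_open_subgroup_complement_not_meager:
  assumes H: "subgroup H G" "\<not> openin T H" and U: "openin T U" "U \<noteq> {}"
  shows "\<not> meager_in T (U - H)"
proof
  assume meager: "meager_in T (U - H)"
  obtain u where u: "u \<in> U" "u \<in> carrier G" using U openin_carrier by blast
  define V where "V = {v \<in> carrier G. v \<otimes> u \<in> U}"
  have "v \<in> H" if v: "v \<in> V" for v
  proof (rule ccontr)
    assume vH: "v \<notin> H"
    have vG: "v \<in> carrier G" using v unfolding V_def by simp
    define W where "W = U \<inter> {x \<in> carrier G. inv v \<otimes> x \<in> U}"
    have "W \<subseteq> (U - H) \<union> (\<lambda>x. v \<otimes> x) ` (U - H)"
    proof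
      fix x assume x: "x \<in> W"
      then have xG: "x \<in> carrier G" and xU: "x \<in> U" "inv v \<otimes> x \<in> U" unfolding W_def by auto
      have x_eq: "x = v \<otimes> (inv v \<otimes> x)" using vG xG by (simp add: m_assoc[symmetric])
      have v_eq: "x \<otimes> inv (inv v \<otimes> x) = v" using vG xG by (simp add: inv_mult_group m_assoc[symmetric])
      show "x \<in> (U - H) \<union> (\<lambda>x. v \<otimes> x) ` (U - H)"
      proof (cases "x \<in> H")
        case True
        have "inv v \<otimes> x \<notin> H"
        proof
          assume "inv v \<otimes> x \<in> H"
          then have "x \<otimes> inv (inv v \<otimes> x) \<in> H"
            using True subgroup.m_closed[OF H(1)] subgroup.m_inv_closed[OF H(1)] by simp
          then show False using vH unfolding v_eq by simp
        qed
        then have "inv v \<otimes> x \<in> U - H" using xU(2) by simp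
        then have "v \<otimes> (inv v \<otimes> x) \<in> (\<lambda>x. v \<otimes> x) ` (U - H)" by (rule imageI)
        then show ?thesis unfolding x_eq[symmetric] by (rule UnI2)
      next
        case False
        then show ?thesis using xU(1) by simp
      qed
    qed
    moreover have "meager_in T ((U - H) \<union> (\<lambda>x. v \<otimes> x) ` (U - H))"
      by (intro meager_in_Un meager meager_in_homeomorphic_image[OF homeomorphic_map_left_mult[OF vG]])
    moreover have "openin T W" unfolding W_def
      using U(1) vG openin_left_mult_preimage by (intro openin_Int) auto
    ultimately have "W = {}" using openin_subset_meager_empty[OF completely_metrizable] by blast
    moreover have "v \<otimes> u \<in> W"
      using v vG u unfolding W_def V_def by (simp add: m_assoc[symmetric])
    ultimately show False by blast
  qed
  moreover have "openin T V" unfolding V_def using openin_right_mult_preimage[OF U(1) u(2)] .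
  moreover have "\<one> \<in> V" unfolding V_def using u by simp
  ultimately show False using openin_subgroup[OF H(1)] H(2) by blast
qed

section \<open>An open mapping theorem for orbit maps\<close>

lemma (in Metric_space) geometric_mcball_limit:
  assumes "mcomplete" and c: "\<And>n. c n \<in> M" and step: "\<And>n. d (c n) (c (Suc n)) \<le> r / 2 ^ n"
    and "r > 0"
  obtains l where "l \<in> M" "\<And>n. d (c n) l \<le> 2 * r / 2 ^ n"
proof -
  define C where "C n = mcball (c n) (2 * r / 2 ^ n)" for n :: nat
  have "C (Suc n) \<subseteq> C n" for n unfolding C_def
    by (rule mcball_subset) (use step[of n] c commute[of "c n"] in \<open>auto simp: field_simps\<close>)
  then have "decseq C" by (rule decseq_SucI)
  moreover have "\<exists>n a. C n \<subseteq> mcball a e" if "e > 0" for e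
  proof -
    have "e / (2 * r) > 0" using that assms(4) by simp
    then obtain n where "(1/2) ^ n < e / (2 * r)"
      using real_arch_pow_inv[of "e / (2 * r)" "1/2"] by auto
    then have "2 * r / 2 ^ n \<le> e" using assms(4) by (simp add: field_simps power_one_over)
    then show ?thesis unfolding C_def using mcball_subset_concentric by blast
  qed
  moreover have "\<And>n. closedin mtopology (C n)" unfolding C_def by auto
  moreover have "C n \<noteq> {}" for n
    using c[of n] assms(4) centre_in_mcball_iff[of "c n" "2 * r / 2 ^ n"] unfolding C_def by force
  ultimately have "\<Inter> (range C) \<noteq> {}"
    using assms(1) unfolding mcomplete_nest by blast
  then obtain l where "\<And>n. l \<in> C n" by auto
  then show ?thesis using that[of l] unfolding C_def by auto
qed

text \<open>
  The core of the open mapping theorem, with the uniformity of the usual hypothesis traded for a back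
  and forth between two maps. The point \<open>\<psi> h\<close> is a limit of values of \<open>\<phi>\<close> near \<open>g\<close>, so \<open>g\<close> can be moved
  slightly to make \<open>\<phi> g\<close> an interior limit of values of \<open>\<psi>\<close> near \<open>h\<close>; then \<open>h\<close> can be moved, and so on
  with halved radii. The two sequences converge, and their images cannot be separated in the limit.
\<close>
lemma (in Metric_space) almost_open_maps_common_value:
  assumes "mcomplete" "Hausdorff_space Y"
    and cont: "continuous_map mtopology Y \<phi>" "continuous_map mtopology Y \<psi>"
    and almost_open:
      "\<And>g e. g \<in> M \<Longrightarrow> e > 0 \<Longrightarrow> \<phi> g \<in> Y interior_of (Y closure_of (\<phi> ` mball g e))"
      "\<And>h e. h \<in> M \<Longrightarrow> e > 0 \<Longrightarrow> \<psi> h \<in> Y interior_of (Y closure_of (\<psi> ` mball h e))"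
    and start: "g \<in> M" "h \<in> M" "r > 0" "\<psi> h \<in> Y interior_of (Y closure_of (\<phi> ` mball g r))"
  obtains g' h' where "g' \<in> M" "h' \<in> M" "d g g' \<le> 2 * r" "d h h' \<le> 2 * r" "\<phi> g' = \<psi> h'"
proof -
  define P where "P n p \<longleftrightarrow> fst p \<in> M \<and> snd p \<in> M \<and> (n = 0 \<longrightarrow> p = (g, h)) \<and>
      \<psi> (snd p) \<in> Y interior_of (Y closure_of (\<phi> ` mball (fst p) (r / 2 ^ n)))" for n :: nat and p
  define Q where "Q n p p' \<longleftrightarrow> d (fst p) (fst p') < r / 2 ^ n \<and> d (snd p) (snd p') < r / 2 ^ n"
    for n :: nat and p p'
  have "\<exists>f. \<forall>n. P n (f n) \<and> Q n (f n) (f (Suc n))"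
  proof (rule dependent_nat_choice)
    show "\<exists>p. P 0 p" using start unfolding P_def by simp
    fix p n assume p: "P n p"
    obtain a b where ab: "p = (a, b)" by (cases p)
    define e where "e = r / 2 ^ n"
    have e: "e > 0" "r / 2 ^ Suc n = e / 2" using start(3) unfolding e_def by auto
    have M: "a \<in> M" "b \<in> M" and b: "\<psi> b \<in> Y closure_of (\<phi> ` mball a e)"
      using p interior_of_subset[of Y "Y closure_of (\<phi> ` mball a e)"] unfolding P_def ab e_def by auto
    have "\<psi> b \<in> Y interior_of (Y closure_of (\<psi> ` mball b e))" using almost_open(2) M(2) e(1) .
    then obtain a' where a': "a' \<in> mball a e" "\<phi> a' \<in> Y interior_of (Y closure_of (\<psi> ` mball b e))"
      using b unfolding in_closure_of by (metis (no_types, lifting) imageE openin_interior_of)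
    then have aM: "a' \<in> M" by auto
    have "\<phi> a' \<in> Y interior_of (Y closure_of (\<phi> ` mball a' (e / 2)))"
      using almost_open(1)[OF aM, of "e / 2"] e(1) by simp
    moreover have "\<phi> a' \<in> Y closure_of (\<psi> ` mball b e)" by (rule subsetD[OF interior_of_subset a'(2)])
    ultimately obtain b' where b': "b' \<in> mball b e"
        "\<psi> b' \<in> Y interior_of (Y closure_of (\<phi> ` mball a' (e / 2)))"
      unfolding in_closure_of by (metis (no_types, lifting) imageE openin_interior_of)
    have "P (Suc n) (a', b')" unfolding P_def e(2) using aM b' by simp
    moreover have "Q n p (a', b')" unfolding Q_def ab using a'(1) b'(1) by (simp add: e_def)
    ultimately show "\<exists>p'. P (Suc n) p' \<and> Q n p p'" by blast
  qed
  then obtain f where f: "\<And>n. P n (f n)" "\<And>n. Q n (f n) (f (Suc n))" by blast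
  obtain g' where g': "g' \<in> M" "\<And>n. d (fst (f n)) g' \<le> 2 * r / 2 ^ n"
    using geometric_mcball_limit[OF assms(1), of "\<lambda>n. fst (f n)" r] f start(3)
    unfolding P_def Q_def by (metis less_imp_le)
  obtain h' where h': "h' \<in> M" "\<And>n. d (snd (f n)) h' \<le> 2 * r / 2 ^ n"
    using geometric_mcball_limit[OF assms(1), of "\<lambda>n. snd (f n)" r] f start(3)
    unfolding P_def Q_def by (metis less_imp_le)
  have "\<phi> g' = \<psi> h'"
  proof (rule ccontr)
    assume "\<phi> g' \<noteq> \<psi> h'"
    moreover have "\<phi> g' \<in> topspace Y" "\<psi> h' \<in> topspace Y"
      using cont g'(1) h'(1) continuous_map_image_subset_topspace by fastforce+
    ultimately obtain A B where AB: "openin Y A" "openin Y B" "\<phi> g' \<in> A" "\<psi> h' \<in> B" "disjnt A B"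
      using assms(2) unfolding Hausdorff_space_def by blast
    have "openin mtopology {x \<in> M. \<phi> x \<in> A}" "openin mtopology {x \<in> M. \<psi> x \<in> B}"
      using openin_continuous_map_preimage[OF cont(1) AB(1)]
        openin_continuous_map_preimage[OF cont(2) AB(2)] by simp_all
    moreover have "g' \<in> {x \<in> M. \<phi> x \<in> A}" "h' \<in> {x \<in> M. \<psi> x \<in> B}"
      using g'(1) h'(1) AB(3,4) by simp_all
    ultimately have "\<exists>s>0. mball g' s \<subseteq> {x \<in> M. \<phi> x \<in> A}" "\<exists>t>0. mball h' t \<subseteq> {x \<in> M. \<psi> x \<in> B}"
      unfolding openin_mtopology by simp_all
    then obtain s t where st: "s > 0" "mball g' s \<subseteq> {x \<in> M. \<phi> x \<in> A}"
        "t > 0" "mball h' t \<subseteq> {x \<in> M. \<psi> x \<in> B}"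
      by (elim exE conjE)
    have "min s t / (3 * r) > 0" using st(1,3) start(3) by simp
    then obtain n where "(1/2) ^ n < min s t / (3 * r)"
      using real_arch_pow_inv[of "min s t / (3 * r)" "1/2"] by auto
    then have n: "3 * (r / 2 ^ n) < min s t" using start(3) by (simp add: field_simps power_one_over)
    define e where "e = r / 2 ^ n"
    have e: "e > 0" "3 * e < s" "3 * e < t" using n start(3) unfolding e_def by auto
    have fn: "fst (f n) \<in> M" "snd (f n) \<in> M" "d (fst (f n)) g' \<le> 2 * e" "d (snd (f n)) h' \<le> 2 * e"
      using f(1)[of n] g'(2)[of n] h'(2)[of n] unfolding P_def e_def by auto
    \<comment> \<open>The distance 2e to the limit and the radius e together stay below s.\<close>
    have "mball (fst (f n)) e \<subseteq> mball g' s"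
      by (rule mball_subset) (use fn e g'(1) in auto)
    then have "Y closure_of (\<phi> ` mball (fst (f n)) e) \<subseteq> Y closure_of A"
      using st(2) by (intro closure_of_mono) auto
    moreover have "\<psi> (snd (f n)) \<in> Y interior_of (Y closure_of (\<phi> ` mball (fst (f n)) e))"
      using f(1)[of n] unfolding P_def e_def by simp
    then have "\<psi> (snd (f n)) \<in> Y closure_of (\<phi> ` mball (fst (f n)) e)"
      by (rule subsetD[OF interior_of_subset])
    ultimately have "\<psi> (snd (f n)) \<in> Y closure_of A" by blast
    moreover have "snd (f n) \<in> mball h' t" using fn e h'(1) commute[of h'] by simp
    then have "\<psi> (snd (f n)) \<in> B" using st(4) by auto
    ultimately show False using AB(2,5) unfolding in_closure_of disjnt_iff by blast
  qed
  then show ?thesis using that g' h' f(1)[of 0] g'(2)[of 0] h'(2)[of 0] unfolding P_def by simp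
qed

text \<open>
  Continuity is required in each variable separately: the maps \<open>act g\<close> serve as homeomorphisms of
  \<open>X\<close>, and the orbit maps are those to which the open mapping argument applies.
\<close>
locale polish_group_action = polish_group +
  fixes X :: "'c topology" and act :: "'a \<Rightarrow> 'c \<Rightarrow> 'c"
  assumes Hausdorff_X: "Hausdorff_space X"
    and completely_metrizable_X: "completely_metrizable_space X"
    and act_one: "x \<in> topspace X \<Longrightarrow> act \<one> x = x"
    and act_mult: "x \<in> topspace X \<Longrightarrow> g \<in> carrier G \<Longrightarrow> h \<in> carrier G \<Longrightarrow>
      act (g \<otimes> h) x = act g (act h x)"
    and continuous_map_act: "g \<in> carrier G \<Longrightarrow> continuous_map X X (act g)"
    and continuous_map_orbit: "x \<in> topspace X \<Longrightarrow> continuous_map T X (\<lambda>g. act g x)"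

context polish_group_action
begin

lemma act_closed: "g \<in> carrier G \<Longrightarrow> x \<in> topspace X \<Longrightarrow> act g x \<in> topspace X"
  using continuous_map_act continuous_map_image_subset_topspace by blast

lemma act_inv [simp]:
  assumes "g \<in> carrier G" "x \<in> topspace X"
  shows "act (inv g) (act g x) = x" "act g (act (inv g) x) = x"
  using assms by (simp_all add: act_mult[symmetric] act_one)

lemma homeomorphic_map_act:
  assumes "g \<in> carrier G"
  shows "homeomorphic_map X X (act g)"
proof -
  have "homeomorphic_maps X X (act g) (act (inv g))"
    unfolding homeomorphic_maps_def using assms by (simp add: continuous_map_act)
  then show ?thesis using homeomorphic_maps_map by blast
qed

lemma orbit_subset_topspace: "x \<in> topspace X \<Longrightarrow> orbit G act x \<subseteq> topspace X"
  unfolding orbit_def using act_closed by auto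

lemma mem_own_orbit: "x \<in> topspace X \<Longrightarrow> x \<in> orbit G act x"
  unfolding orbit_def using act_one by force

lemma orbit_eq:
  assumes "x \<in> topspace X" "y \<in> orbit G act x"
  shows "orbit G act y = orbit G act x"
proof -
  obtain g where g: "g \<in> carrier G" "y = act g x" using assms(2) unfolding orbit_def by auto
  have "act h y \<in> orbit G act x" if "h \<in> carrier G" for h
    unfolding orbit_def g(2) using that g(1) assms(1) act_mult[symmetric] by auto
  moreover have "act h x \<in> orbit G act y" if "h \<in> carrier G" for h
  proof -
    have "act h x = act (h \<otimes> inv g) y"
      unfolding g(2) using that g(1) assms(1) by (simp add: act_mult act_closed)
    then show ?thesis unfolding orbit_def using that g(1) by blast
  qed
  ultimately show ?thesis unfolding orbit_def by blast
qed

text \<open>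
  By separability countably many left translates of \<open>U\<close> cover the group, so the orbit is a countable
  union of homeomorphic copies of the piece.
\<close>
lemma not_meager_orbit_piece:
  assumes x: "x \<in> topspace X" "comeager_in X (orbit G act x)" and U: "openin T U" "U \<noteq> {}"
  shows "\<not> meager_in X ((\<lambda>g. act g x) ` U)"
proof
  assume meager: "meager_in X ((\<lambda>g. act g x) ` U)"
  obtain C where C: "countable C" "C \<subseteq> carrier G" "T closure_of C = carrier G"
    using separable unfolding separable_space_def topspace_eq_carrier by blast
  obtain u where u: "u \<in> U" "u \<in> carrier G" using U openin_carrier by blast
  have "orbit G act x \<subseteq> (\<Union>c\<in>C. act c ` (\<lambda>g. act g x) ` U)"
  proof
    fix y assume "y \<in> orbit G act x"
    then obtain g where g: "g \<in> carrier G" "y = act g x" unfolding orbit_def by auto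
    have "openin T {c \<in> carrier G. inv c \<in> {d \<in> carrier G. d \<otimes> g \<in> U}}"
      by (intro openin_inv_preimage openin_right_mult_preimage U(1) g(1))
    moreover have "g \<otimes> inv u \<in> {c \<in> carrier G. inv c \<in> {d \<in> carrier G. d \<otimes> g \<in> U}}"
      using g(1) u by (simp add: inv_mult_group m_assoc)
    ultimately obtain c where c: "c \<in> C" "c \<in> carrier G" "inv c \<otimes> g \<in> U"
      using C(3) dense_intersects_open[of T C] unfolding topspace_eq_carrier by blast
    have "y = act c (act (inv c \<otimes> g) x)"
      using c(2) g x(1) by (simp add: act_mult[symmetric] m_assoc[symmetric])
    then show "y \<in> (\<Union>c\<in>C. act c ` (\<lambda>g. act g x) ` U)" using c(1,3) by blast
  qed
  moreover have "meager_in X (\<Union>c\<in>C. act c ` (\<lambda>g. act g x) ` U)"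
    using C meager homeomorphic_map_act
    by (intro meager_in_UN meager_in_homeomorphic_image[of X X]) auto
  ultimately have "meager_in X (orbit G act x)" using meager_in_subset by blast
  then have "meager_in X (orbit G act x \<union> (topspace X - orbit G act x))"
    using x(2) unfolding comeager_in_def by (intro meager_in_Un) auto
  then have "topspace X = {}"
    by (intro openin_subset_meager_empty[OF completely_metrizable_X]) auto
  then show False using x(1) by simp
qed

text \<open>
  For a small neighbourhood \<open>N\<close> of \<open>\<one>\<close>, the closure of \<open>N \<cdot> g x\<close> has an interior point of the form
  \<open>n g x\<close> with \<open>n \<in> N\<close>. Translation by \<open>n\<inverse>\<close> turns it into \<open>g x\<close>, at the cost of enlarging \<open>N\<close> to
  \<open>N\<inverse> N\<close>.
\<close>
lemma orbit_map_almost_open: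
  assumes x: "x \<in> topspace X" "comeager_in X (orbit G act x)" and U: "openin T U" "g \<in> U"
  shows "act g x \<in> X interior_of (X closure_of ((\<lambda>g. act g x) ` U))"
proof -
  have g: "g \<in> carrier G" using U openin_carrier by blast
  define z where "z = act g x"
  have z: "z \<in> topspace X" "comeager_in X (orbit G act z)"
  proof -
    show "z \<in> topspace X" using g x(1) act_closed unfolding z_def by simp
    have "z \<in> orbit G act x" using g unfolding z_def orbit_def by blast
    then show "comeager_in X (orbit G act z)" using x(2) orbit_eq[OF x(1)] by simp
  qed
  obtain N where N: "openin T N" "\<one> \<in> N" "\<And>a b. a \<in> N \<Longrightarrow> b \<in> N \<Longrightarrow> inv a \<otimes> b \<otimes> g \<in> U"
    using inv_mult_neighbourhood[OF U] by metis
  have NG: "N \<subseteq> carrier G" using N(1) openin_carrier by blast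
  let ?S = "(\<lambda>g. act g z) ` N"
  have ST: "?S \<subseteq> topspace X" using NG z(1) act_closed by auto
  have "\<not> nowhere_dense_in X ?S"
  proof
    assume "nowhere_dense_in X ?S"
    then have "meager_in X ?S" unfolding meager_in_def by (intro exI[of _ "{?S}"]) auto
    then show False using not_meager_orbit_piece[OF z N(1)] N(2) by blast
  qed
  then obtain w where w: "w \<in> X interior_of (X closure_of ?S)"
    using ST unfolding nowhere_dense_in_def by blast
  then have "w \<in> X closure_of ?S" by (rule subsetD[OF interior_of_subset])
  then obtain n where n: "n \<in> N" "act n z \<in> X interior_of (X closure_of ?S)"
    using w openin_interior_of[of X "X closure_of ?S"] unfolding in_closure_of by blast
  have nG: "n \<in> carrier G" "inv n \<in> carrier G" using n NG by auto
  let ?I = "act (inv n) ` (X interior_of (X closure_of ?S))"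
  have "?I = X interior_of (X closure_of (act (inv n) ` ?S))"
    by (simp only: homeomorphic_map_closure_of[OF homeomorphic_map_act[OF nG(2)] ST]
        homeomorphic_map_interior_of[OF homeomorphic_map_act[OF nG(2)] closure_of_subset_topspace])
  also have "\<dots> \<subseteq> X interior_of (X closure_of ((\<lambda>g. act g x) ` U))"
  proof (intro interior_of_mono closure_of_mono, clarify)
    fix b assume b: "b \<in> N"
    then have "act (inv n) (act b z) = act (inv n \<otimes> b \<otimes> g) x"
      unfolding z_def using nG NG g x(1) by (auto simp: act_mult act_closed)
    then show "act (inv n) (act b z) \<in> (\<lambda>g. act g x) ` U" using N(3)[OF n(1) b] by auto
  qed
  finally have "?I \<subseteq> X interior_of (X closure_of ((\<lambda>g. act g x) ` U))" .
  moreover have "act (inv n) (act n z) \<in> ?I" using n(2) by blast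
  ultimately show ?thesis using nG z(1) unfolding z_def by auto
qed

text \<open>
  The theorem of Effros for comeager orbits: the orbit maps of \<open>x\<close> and \<open>y\<close> are both almost open, so
  if \<open>y\<close> is an interior limit of points near \<open>x\<close> on its orbit, then \<open>a x = b y\<close> for some \<open>a\<close> and \<open>b\<close>
  near \<open>\<one>\<close>, and \<open>a\<inverse> b\<close> takes \<open>y\<close> to \<open>x\<close>.
\<close>
lemma comeager_orbit_locally_transitive:
  assumes x: "x \<in> topspace X" "comeager_in X (orbit G act x)" and V: "openin T V" "\<one> \<in> V"
  obtains W where "openin X W" "x \<in> W"
    "\<And>y. y \<in> W \<Longrightarrow> y \<in> orbit G act x \<Longrightarrow> \<exists>v\<in>V. act v y = x"
proof -
  obtain M d where M: "Metric_space M d" "Metric_space.mcomplete M d" "T = Metric_space.mtopology M d"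
    using completely_metrizable unfolding completely_metrizable_space_def by blast
  interpret Metric_space M d by fact
  have MG: "M = carrier G" using M(3) topspace_eq_carrier by simp
  obtain N where N: "openin T N" "\<one> \<in> N" "\<And>a b. a \<in> N \<Longrightarrow> b \<in> N \<Longrightarrow> inv a \<otimes> b \<otimes> \<one> \<in> V"
    using inv_mult_neighbourhood[OF V] by metis
  obtain r where r: "r > 0" "mcball \<one> r \<subseteq> N"
    using N(1,2) unfolding M(3) openin_mtopology_mcball by blast
  \<comment> \<open>The common value is found within twice the radius of the starting ball, hence the factor 1/2.\<close>
  define W where "W = X interior_of (X closure_of ((\<lambda>g. act g x) ` mball \<one> (r / 2)))"
  have ao: "act g y \<in> X interior_of (X closure_of ((\<lambda>g. act g y) ` mball g e))"
    if "y \<in> orbit G act x" "g \<in> M" "e > 0" for y g e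
  proof (rule orbit_map_almost_open)
    show "y \<in> topspace X" "comeager_in X (orbit G act y)"
      using that(1) x orbit_eq[OF x(1)] orbit_subset_topspace by auto
  qed (use that M(3) in auto)
  show ?thesis
  proof (rule that[of W])
    show "openin X W" unfolding W_def by simp
    show "x \<in> W"
      using ao[OF mem_own_orbit[OF x(1)], of \<one> "r/2"] r(1) x(1) act_one MG unfolding W_def by simp
    fix y assume y: "y \<in> W" "y \<in> orbit G act x"
    have yX: "y \<in> topspace X" using y(2) orbit_subset_topspace x(1) by blast
    obtain a b where ab: "a \<in> M" "b \<in> M" "d \<one> a \<le> 2 * (r / 2)" "d \<one> b \<le> 2 * (r / 2)"
      "act a x = act b y"
    proof (rule almost_open_maps_common_value[of X "\<lambda>g. act g x" "\<lambda>g. act g y" \<one> \<one> "r / 2"])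
      show "act \<one> y \<in> X interior_of (X closure_of ((\<lambda>g. act g x) ` mball \<one> (r / 2)))"
        using y(1) yX act_one unfolding W_def by simp
    qed (use M ao y(2) mem_own_orbit[OF x(1)] continuous_map_orbit x(1) yX Hausdorff_X MG r(1) in auto)
    have "\<one> \<in> M" using MG by simp
    then have "a \<in> mcball \<one> r" "b \<in> mcball \<one> r" using ab by simp_all
    then have "a \<in> N" "b \<in> N" using r(2) by auto
    then have "inv a \<otimes> b \<in> V" using N(3)[of a b] ab(1,2) MG by simp
    moreover have "act (inv a \<otimes> b) y = x"
      using ab MG yX x(1) by (simp add: act_mult flip: ab(5))
    ultimately show "\<exists>v\<in>V. act v y = x" by blast
  qed
qed

end

section \<open>Extending generic tuples\<close>

text \<open>
  There is only one comeager orbit, since two of them must meet.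
\<close>
lemma (in polish_group_action) comeager_orbits_eq:
  assumes "x \<in> topspace X" "comeager_in X (orbit G act x)"
    and "y \<in> topspace X" "comeager_in X (orbit G act y)"
  shows "orbit G act x = orbit G act y"
proof -
  have "comeager_in X (\<Inter>z\<in>{x, y}. orbit G act z)"
    using assms by (intro comeager_in_INT) auto
  moreover have "topspace X \<noteq> {}" using assms(1) by blast
  ultimately have "(\<Inter>z\<in>{x, y}. orbit G act z) \<noteq> {}"
    using comeager_in_nonempty[OF completely_metrizable_X] by simp
  then obtain z where "z \<in> orbit G act x" "z \<in> orbit G act y" by auto
  then show ?thesis
    using trans[OF sym[OF orbit_eq[OF assms(1)]] orbit_eq[OF assms(3)]] by blast
qed

context polish_group
begin

lemma Hausdorff: "Hausdorff_space T"
  using completely_metrizable completely_metrizable_imp_metrizable_space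
    metrizable_imp_Hausdorff_space by blast

lemma power_topology_component:
  "x \<in> topspace (power_topology T n) \<Longrightarrow> i < n \<Longrightarrow> x i \<in> carrier G"
  unfolding topspace_power_topology topspace_eq_carrier by (auto dest: PiE_mem)

lemma diag_conj_action: "polish_group_action G T (power_topology T n) (diag_conj G n)"
proof unfold_locales
  show "Hausdorff_space (power_topology T n)"
    unfolding power_topology_def Hausdorff_space_product_topology using Hausdorff by simp
  show "completely_metrizable_space (power_topology T n)"
    unfolding power_topology_def completely_metrizable_space_product_topology
    using completely_metrizable by (simp add: countable_finite)
  show "diag_conj G n \<one> x = x" if x: "x \<in> topspace (power_topology T n)" for x
  proof
    fix i show "diag_conj G n \<one> x i = x i"
      using x power_topology_component[OF x, of i] unfolding diag_conj_def topspace_power_topology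
      by (auto simp: PiE_def extensional_def)
  qed
  show "diag_conj G n (g \<otimes> h) x = diag_conj G n g (diag_conj G n h x)"
    if x: "x \<in> topspace (power_topology T n)" "g \<in> carrier G" "h \<in> carrier G" for x g h
  proof
    fix i show "diag_conj G n (g \<otimes> h) x i = diag_conj G n g (diag_conj G n h x) i"
      using x power_topology_component[OF x(1), of i] unfolding diag_conj_def
      by (auto simp: inv_mult_group m_assoc)
  qed
  show "continuous_map (power_topology T n) (power_topology T n) (diag_conj G n g)"
    if g: "g \<in> carrier G" for g
    unfolding continuous_map_power_topology
  proof (intro conjI allI impI)
    show "diag_conj G n g ` topspace (power_topology T n) \<subseteq> extensional {..<n}"
      unfolding diag_conj_def by auto
    fix i assume "i < n"
    then show "continuous_map (power_topology T n) T (\<lambda>x. diag_conj G n g x i)"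
      unfolding diag_conj_def using g
      by (auto intro!: continuous_intros continuous_map_power_projection)
  qed
  show "continuous_map T (power_topology T n) (\<lambda>g. diag_conj G n g x)"
    if x: "x \<in> topspace (power_topology T n)" for x
    unfolding continuous_map_power_topology
  proof (intro conjI allI impI)
    show "(\<lambda>g. diag_conj G n g x) ` topspace T \<subseteq> extensional {..<n}"
      unfolding diag_conj_def by auto
    fix i assume i: "i < n"
    have "continuous_map T T (\<lambda>g. g \<otimes> x i \<otimes> inv g)"
      using power_topology_component[OF x i]
      by (intro continuous_intros) (auto simp: continuous_map_id[unfolded id_def])
    then show "continuous_map T T (\<lambda>g. diag_conj G n g x i)"
      unfolding diag_conj_def using i by simp
  qed
qed

lemma diag_conj_update:
  "diag_conj G (Suc n) g (x(n := y)) = (diag_conj G n g x)(n := g \<otimes> y \<otimes> inv g)"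
  unfolding diag_conj_def by (auto simp: fun_eq_iff less_Suc_eq)

lemma diag_conj_update_eq_iff:
  "diag_conj G (Suc n) g (x(n := y)) = diag_conj G (Suc n) h (z(n := u)) \<longleftrightarrow>
     diag_conj G n g x = diag_conj G n h z \<and> g \<otimes> y \<otimes> inv g = h \<otimes> u \<otimes> inv h"
proof -
  have "f(n := a) = f'(n := b) \<longleftrightarrow> f = f' \<and> a = b" if "f n = f' n" for f f' :: "nat \<Rightarrow> 'a" and a b
    using that by (metis fun_upd_same fun_upd_triv fun_upd_upd)
  moreover have "diag_conj G n g x n = diag_conj G n h z n" by (simp add: diag_conj_def)
  ultimately show ?thesis unfolding diag_conj_update by blast
qed

definition generic_tuple :: "nat \<Rightarrow> (nat \<Rightarrow> 'a) \<Rightarrow> bool" where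
  "generic_tuple n x \<longleftrightarrow> x \<in> topspace (power_topology T n) \<and>
     comeager_in (power_topology T n) (orbit G (diag_conj G n) x)"

text \<open>
  Almost all tuples of length \<open>n\<close> have comeagerly many generic extensions, so some conjugate of \<open>x\<close>
  does. Conjugating back preserves genericity of the extended tuples.
\<close>
lemma comeager_generic_extensions:
  assumes ample: "ample_generics G T" and x: "generic_tuple n x"
  shows "comeager_in T {y \<in> carrier G. generic_tuple (Suc n) (x(n := y))}"
proof -
  interpret A: polish_group_action G T "power_topology T n" "diag_conj G n" by (rule diag_conj_action)
  interpret A': polish_group_action G T "power_topology T (Suc n)" "diag_conj G (Suc n)"
    by (rule diag_conj_action)
  have xX: "x \<in> topspace (power_topology T n)" using x unfolding generic_tuple_def by simp
  obtain z where z: "generic_tuple (Suc n) z"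
    using ample unfolding ample_generics_def generic_tuple_def by (metis le_add1 plus_1_eq_Suc)
  define O' where "O' = orbit G (diag_conj G (Suc n)) z"
  have zX: "z \<in> topspace (power_topology T (Suc n))" and O': "comeager_in (power_topology T (Suc n)) O'"
    using z unfolding generic_tuple_def O'_def by auto
  have generic: "generic_tuple (Suc n) y" if "y \<in> O'" for y
    using that zX O' A'.orbit_eq[OF zX] A'.orbit_subset_topspace[OF zX]
    unfolding generic_tuple_def O'_def by auto
  define S where "S = {x \<in> topspace (power_topology T n). comeager_in T {y \<in> topspace T. x(n := y) \<in> O'}}"
  have "comeager_in (power_topology T n) S" unfolding S_def
    using comeager_in_power_sections[OF _ separable O'] completely_metrizable
      completely_metrizable_imp_metrizable_space by blast
  then have "comeager_in (power_topology T n) (\<Inter>Y\<in>{S, orbit G (diag_conj G n) x}. Y)"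
    using x unfolding generic_tuple_def by (intro comeager_in_INT) auto
  moreover have "topspace (power_topology T n) \<noteq> {}" using xX by blast
  ultimately have "S \<inter> orbit G (diag_conj G n) x \<noteq> {}"
    using comeager_in_nonempty[OF A.completely_metrizable_X] by fastforce
  then obtain g where g: "g \<in> carrier G" "diag_conj G n g x \<in> S"
    unfolding orbit_def by auto
  let ?c = "\<lambda>y. inv g \<otimes> y \<otimes> inv (inv g)"
  have "comeager_in T (?c ` {y \<in> topspace T. (diag_conj G n g x)(n := y) \<in> O'})"
    using g(2) comeager_in_homeomorphic_image[OF homeomorphic_map_conjugation[OF inv_closed[OF g(1)]]]
    unfolding S_def by simp
  then show ?thesis
  proof (rule comeager_in_superset)
    show "?c ` {y \<in> topspace T. (diag_conj G n g x)(n := y) \<in> O'} \<subseteq>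
        {y \<in> carrier G. generic_tuple (Suc n) (x(n := y))}"
    proof clarify
      fix y assume y: "y \<in> topspace T" "(diag_conj G n g x)(n := y) \<in> O'"
      then have yG: "y \<in> carrier G" by (simp add: topspace_eq_carrier)
      have "diag_conj G (Suc n) (inv g) ((diag_conj G n g x)(n := y)) \<in> O'"
      proof -
        have "orbit G (diag_conj G (Suc n)) ((diag_conj G n g x)(n := y)) = O'"
          using A'.orbit_eq[OF zX] y(2) unfolding O'_def by blast
        then show ?thesis using g(1) unfolding orbit_def by blast
      qed
      moreover have "diag_conj G (Suc n) (inv g) ((diag_conj G n g x)(n := y)) = x(n := ?c y)"
        using g(1) xX unfolding diag_conj_update by simp
      ultimately show "?c y \<in> carrier G \<and> generic_tuple (Suc n) (x(n := ?c y))"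
        using generic yG g(1) by simp
    qed
  qed (auto simp: topspace_eq_carrier)
qed

text \<open>
  Choose \<open>a \<in> A\<close> with \<open>(x, a)\<close> generic. For \<open>y\<close> close to \<open>a\<close>, the tuple \<open>(x, y)\<close> is close to \<open>(x, a)\<close>;
  if it is generic, then it is carried to \<open>(x, a)\<close> by an element of \<open>V\<close>. As \<open>B\<close> is non-meager near \<open>a\<close>,
  such a \<open>y\<close> exists in \<open>B\<close>.
\<close>
lemma exists_conjugate_generic_extensions:
  assumes ample: "ample_generics G T" and x: "generic_tuple n x"
    and A: "\<not> meager_in T A" "A \<subseteq> carrier G"
    and B: "\<And>U. openin T U \<Longrightarrow> U \<noteq> {} \<Longrightarrow> \<not> meager_in T (U \<inter> B)"
    and V: "openin T V" "\<one> \<in> V"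
  obtains a b v where "a \<in> A" "b \<in> B" "v \<in> V"
    "generic_tuple (Suc n) (x(n := a))" "generic_tuple (Suc n) (x(n := b))"
    "diag_conj G n v x = x" "v \<otimes> b \<otimes> inv v = a"
proof -
  interpret C: polish_group_action G T "power_topology T n" "diag_conj G n" by (rule diag_conj_action)
  interpret C': polish_group_action G T "power_topology T (Suc n)" "diag_conj G (Suc n)"
    by (rule diag_conj_action)
  have xX: "x \<in> topspace (power_topology T n)" using x unfolding generic_tuple_def by simp
  define E where "E = {y \<in> carrier G. generic_tuple (Suc n) (x(n := y))}"
  have E: "comeager_in T E" unfolding E_def by (rule comeager_generic_extensions[OF ample x])
  obtain a where a: "a \<in> A" "a \<in> E"
    using not_meager_meets_comeager[OF E A(1)] A(2) topspace_eq_carrier by auto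
  have xa: "x(n := a) \<in> topspace (power_topology T (Suc n))"
    "comeager_in (power_topology T (Suc n)) (orbit G (diag_conj G (Suc n)) (x(n := a)))"
    using a(2) unfolding E_def generic_tuple_def by auto
  obtain W where W: "openin (power_topology T (Suc n)) W" "x(n := a) \<in> W"
    "\<And>y. y \<in> W \<Longrightarrow> y \<in> orbit G (diag_conj G (Suc n)) (x(n := a)) \<Longrightarrow>
       \<exists>v\<in>V. diag_conj G (Suc n) v y = x(n := a)"
    using C'.comeager_orbit_locally_transitive[OF xa V] by metis
  define U where "U = {y \<in> topspace T. x(n := y) \<in> W}"
  have "openin T U" unfolding U_def
    by (rule openin_continuous_map_preimage[OF continuous_map_power_update_right[OF xX] W(1)])
  moreover have "a \<in> U" using a W(2) unfolding U_def E_def topspace_eq_carrier by simp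
  ultimately have "\<not> meager_in T (U \<inter> B)" "U \<inter> B \<subseteq> topspace T" using B unfolding U_def by auto
  then obtain b where b: "b \<in> U" "b \<in> B" "b \<in> E" using not_meager_meets_comeager[OF E] by blast
  have "x(n := b) \<in> orbit G (diag_conj G (Suc n)) (x(n := a))"
    using C'.comeager_orbits_eq[OF xa] C'.mem_own_orbit b(3) unfolding E_def generic_tuple_def by auto
  then obtain v where v: "v \<in> V" "diag_conj G (Suc n) v (x(n := b)) = x(n := a)"
    using W(3) b(1) unfolding U_def by auto
  have "diag_conj G (Suc n) v (x(n := b)) = diag_conj G (Suc n) \<one> (x(n := a))"
    using v(2) C'.act_one xa(1) by simp
  then have "diag_conj G n v x = x" "v \<otimes> b \<otimes> inv v = a"
    using C.act_one[OF xX] a(2) unfolding diag_conj_update_eq_iff E_def by auto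
  then show ?thesis using that a b v unfolding E_def by blast
qed

end

section \<open>Escaping countably many cosets\<close>

context polish_group
begin

text \<open>
  The coset \<open>h C(x)\<close> of the centralizer of the tuple \<open>x\<close>. Stated as the solution set of an equation it is
  visibly closed, and visibly decreasing when \<open>x\<close> is extended.
\<close>
definition transporter :: "nat \<Rightarrow> (nat \<Rightarrow> 'a) \<Rightarrow> 'a \<Rightarrow> 'a set" where
  "transporter n x h = {c \<in> carrier G. diag_conj G n c x = diag_conj G n h x}"

lemma closedin_transporter:
  assumes "x \<in> topspace (power_topology T n)" "h \<in> carrier G"
  shows "closedin T (transporter n x h)"
proof -
  interpret A: polish_group_action G T "power_topology T n" "diag_conj G n" by (rule diag_conj_action)
  have "closedin T {c \<in> topspace T. diag_conj G n c x = diag_conj G n h x}"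
    using A.continuous_map_orbit[OF assms(1)] A.act_closed[OF assms(2,1)]
    by (intro closedin_continuous_maps_eq[OF A.Hausdorff_X]) auto
  then show ?thesis unfolding transporter_def topspace_eq_carrier .
qed

lemma transporter_update_subset: "transporter (Suc n) (x(n := a)) h \<subseteq> transporter n x h"
  unfolding transporter_def by (auto simp: diag_conj_update_eq_iff)

lemma transporter_mult_stabilizer:
  assumes "x \<in> topspace (power_topology T n)" "h \<in> carrier G" "v \<in> carrier G"
    and "diag_conj G n v x = x"
  shows "transporter n x (h \<otimes> v) = transporter n x h"
proof -
  interpret A: polish_group_action G T "power_topology T n" "diag_conj G n" by (rule diag_conj_action)
  show ?thesis unfolding transporter_def using A.act_mult[OF assms(1-3)] assms(4) by simp
qed

text \<open>
  Both tuples \<open>(x, a)\<close> and \<open>(x, b)\<close> are moved to the same place, the first one by \<open>c\<close> and the second one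
  by \<open>e\<close>, because \<open>v\<close> conjugates \<open>b\<close> to \<open>a\<close>. Hence \<open>e\<inverse> c\<close> conjugates \<open>a\<close> to \<open>b\<close>. If \<open>u c\<close> and \<open>u e\<close> lie in the
  same left coset of \<open>H\<close>, then \<open>e\<inverse> c \<in> H\<close>, and \<open>a \<in> H\<close> forces \<open>b \<in> H\<close>.
\<close>
lemma transporters_not_both_meet_coset:
  assumes H: "subgroup H G" "a \<in> H" "b \<notin> H"
    and carr: "b \<in> carrier G" "h \<in> carrier G" "v \<in> carrier G" "u \<in> carrier G" "k \<in> carrier G"
    and conj: "v \<otimes> b \<otimes> inv v = a"
    and c: "c \<in> transporter (Suc n) (x(n := a)) h" "u \<otimes> c \<in> k <# H"
    and e: "e \<in> transporter (Suc n) (x(n := b)) (h \<otimes> v)" "u \<otimes> e \<in> k <# H"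
  shows False
proof -
  have aG: "a \<in> carrier G" using subgroup.mem_carrier[OF H(1,2)] .
  have cG: "c \<in> carrier G" "e \<in> carrier G" using c e unfolding transporter_def by auto
  have ca: "c \<otimes> a \<otimes> inv c = h \<otimes> a \<otimes> inv h"
    using c(1) unfolding transporter_def by (simp add: diag_conj_update_eq_iff)
  have "e \<otimes> b \<otimes> inv e = (h \<otimes> v) \<otimes> b \<otimes> inv (h \<otimes> v)"
    using e(1) unfolding transporter_def by (simp add: diag_conj_update_eq_iff)
  also have "\<dots> = h \<otimes> (v \<otimes> b \<otimes> inv v) \<otimes> inv h"
    using carr by (simp add: inv_mult_group m_assoc)
  finally have eb: "e \<otimes> b \<otimes> inv e = c \<otimes> a \<otimes> inv c" using ca conj by simp
  obtain p q where pq: "p \<in> H" "u \<otimes> c = k \<otimes> p" "q \<in> H" "u \<otimes> e = k \<otimes> q"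
    using c(2) e(2) unfolding l_coset_def by auto
  have pqG: "p \<in> carrier G" "q \<in> carrier G" using pq subgroup.mem_carrier[OF H(1)] by auto
  define t where "t = inv q \<otimes> p"
  have t: "t \<in> H" "t \<in> carrier G"
    using pq pqG subgroup.m_closed[OF H(1)] subgroup.m_inv_closed[OF H(1)] unfolding t_def by auto
  have cancel: "inv r \<otimes> (r \<otimes> s) = s" if "r \<in> carrier G" "s \<in> carrier G" for r s
    using that by (simp add: m_assoc[symmetric])
  have "t = inv (k \<otimes> q) \<otimes> (k \<otimes> p)"
    unfolding t_def using carr(5) pqG by (simp add: inv_mult_group m_assoc cancel)
  also have "\<dots> = inv (u \<otimes> e) \<otimes> (u \<otimes> c)" using pq by simp
  also have "\<dots> = inv e \<otimes> c" using carr(4) cG by (simp add: inv_mult_group m_assoc cancel)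
  finally have t_eq: "t = inv e \<otimes> c" .
  have "b = inv e \<otimes> (e \<otimes> b \<otimes> inv e) \<otimes> e"
    using carr(1) cG by (simp add: m_assoc cancel)
  also have "\<dots> = t \<otimes> a \<otimes> inv t"
    unfolding eb t_eq using aG cG by (simp add: inv_mult_group m_assoc)
  finally have "b = t \<otimes> a \<otimes> inv t" .
  then have "b \<in> H"
    using t(1) H(2) subgroup.m_closed[OF H(1)] subgroup.m_inv_closed[OF H(1)] by auto
  then show False using H(3) by simp
qed

end

lemma (in polish_group) countable_translate_into_comeager:
  assumes "countable S" "S \<subseteq> carrier G" "comeager_in T D"
  obtains w where "w \<in> carrier G" "\<And>h. h \<in> S \<Longrightarrow> w \<otimes> h \<in> D"
proof -
  let ?E = "\<lambda>h. (\<lambda>z. z \<otimes> inv h) ` D"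
  have DG: "D \<subseteq> carrier G" using assms(3) unfolding comeager_in_def topspace_eq_carrier by simp
  have "comeager_in T (\<Inter>h\<in>insert \<one> S. ?E h)"
  proof (rule comeager_in_INT)
    fix h assume "h \<in> insert \<one> S"
    then have "inv h \<in> carrier G" using assms(2) by auto
    then show "comeager_in T (?E h)"
      by (rule comeager_in_homeomorphic_image[OF homeomorphic_map_right_mult assms(3)])
  qed (use assms(1) in auto)
  moreover have "topspace T \<noteq> {}" using one_closed topspace_eq_carrier by blast
  ultimately have "(\<Inter>h\<in>insert \<one> S. ?E h) \<noteq> {}"
    using comeager_in_nonempty[OF completely_metrizable] by blast
  then obtain w where w: "\<And>h. h \<in> insert \<one> S \<Longrightarrow> w \<in> ?E h" by blast
  show ?thesis
  proof (rule that[of w])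
    show "w \<in> carrier G" using w[of \<one>] DG by auto
    fix h assume h: "h \<in> S"
    then obtain z where z: "z \<in> D" "w = z \<otimes> inv h" using w[of h] by auto
    then have "w \<otimes> h = z" using subsetD[OF assms(2) h] subsetD[OF DG z(1)] by (simp add: m_assoc)
    then show "w \<otimes> h \<in> D" using z(1) by simp
  qed
qed

text \<open>
  A meager subgroup may fail to contain any \<open>a\<close> with \<open>(x, a)\<close> generic, so separation by \<open>H\<close> is promised
  only for non-meager \<open>H\<close>. The extensions themselves exist in both cases, which keeps the construction uniform.
\<close>
lemma (in polish_group) exists_separating_generic_extensions:
  assumes ample: "ample_generics G T" and x: "generic_tuple n x"
    and H: "subgroup H G" "\<not> openin T H" and V: "openin T V" "\<one> \<in> V"
  obtains a b v where "v \<in> V" "b \<in> carrier G"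
    "generic_tuple (Suc n) (x(n := a))" "generic_tuple (Suc n) (x(n := b))"
    "diag_conj G n v x = x" "v \<otimes> b \<otimes> inv v = a"
    "\<not> meager_in T H \<Longrightarrow> a \<in> H \<and> b \<notin> H"
proof -
  define A where "A = (if meager_in T H then carrier G else H)"
  define B where "B = (if meager_in T H then carrier G else carrier G - H)"
  have open_not_meager: "\<not> meager_in T U" if "openin T U" "U \<noteq> {}" for U
    using openin_subset_meager_empty[OF completely_metrizable _ that(1) order_refl] that(2) by blast
  have "openin T (carrier G)" using openin_topspace[of T] unfolding topspace_eq_carrier .
  then have "\<not> meager_in T (carrier G)" using open_not_meager one_closed by blast
  then have A: "\<not> meager_in T A" "A \<subseteq> carrier G"
    using subgroup.subset[OF H(1)] unfolding A_def by simp_all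
  have B: "\<not> meager_in T (U \<inter> B)" if U: "openin T U" "U \<noteq> {}" for U
  proof -
    have "U \<inter> B = (if meager_in T H then U else U - H)"
      using openin_carrier[OF U(1)] unfolding B_def by auto
    then show ?thesis
      using open_not_meager[OF U] non_open_subgroup_complement_not_meager[OF H U] by simp
  qed
  obtain a b v where abv: "a \<in> A" "b \<in> B" "v \<in> V"
    "generic_tuple (Suc n) (x(n := a))" "generic_tuple (Suc n) (x(n := b))"
    "diag_conj G n v x = x" "v \<otimes> b \<otimes> inv v = a"
    by (rule exists_conjugate_generic_extensions[OF ample x A B V])
  show ?thesis
  proof (rule that[OF abv(3) _ abv(4-7)])
    show "b \<in> carrier G" using abv(2) unfolding B_def by (simp split: if_splits)
    show "a \<in> H \<and> b \<notin> H" if "\<not> meager_in T H" using that abv(1,2) unfolding A_def B_def by simp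
  qed
qed

text \<open>
  Finite words in countably many maps can be indexed by lists.
\<close>
lemma countable_set_closed_under_countably_many_maps:
  fixes f :: "'c :: countable \<Rightarrow> 's \<Rightarrow> 's"
  assumes "P s0" "\<And>c s. P s \<Longrightarrow> P (f c s)"
  obtains S where "countable S" "s0 \<in> S" "\<forall>s\<in>S. P s" "\<forall>s\<in>S. \<forall>c. f c s \<in> S"
proof (rule that[of "range (\<lambda>l. foldr f l s0)"])
  have "foldr f [] s0 = s0" by simp
  then show "s0 \<in> range (\<lambda>l. foldr f l s0)" by (metis rangeI)
  have "P (foldr f l s0)" for l by (induction l) (use assms in auto)
  then show "\<forall>s\<in>range (\<lambda>l. foldr f l s0). P s" by blast
  have "f c (foldr f l s0) = foldr f (c # l) s0" for c l by simp
  then show "\<forall>s\<in>range (\<lambda>l. foldr f l s0). \<forall>c. f c s \<in> range (\<lambda>l. foldr f l s0)"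
    by (metis (no_types, lifting) rangeE rangeI)
qed simp

text \<open>
  The countable set \<open>S\<close> contains all states \<open>(n, x, h)\<close> that the construction can reach, where stage \<open>n\<close>
  deals with \<open>H n\<close> and \<open>V\<close> enumerates the permitted neighbourhoods of \<open>\<one>\<close>. The tuple has length
  \<open>Suc n\<close> because genericity is provided for positive lengths. Having all states at
  hand in advance permits a single translation to be chosen for all of them.
\<close>
lemma (in polish_group) countable_generic_branching:
  fixes H V :: "nat \<Rightarrow> 'a set"
  assumes ample: "ample_generics G T"
    and H: "\<And>i. subgroup (H i) G" "\<And>i. \<not> openin T (H i)"
    and V: "\<And>m. openin T (V m)" "\<And>m. \<one> \<in> V m"
  obtains S and x0 :: "nat \<Rightarrow> 'a" where "countable S" "(0, x0, \<one>) \<in> S"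
    "\<forall>(n, x, h)\<in>S. generic_tuple (Suc n) x \<and> h \<in> carrier G"
    "\<forall>(n, x, h)\<in>S. \<forall>m. \<exists>a b v. v \<in> V m \<and> b \<in> carrier G \<and>
       (Suc n, x(Suc n := a), h) \<in> S \<and> (Suc n, x(Suc n := b), h \<otimes> v) \<in> S \<and>
       diag_conj G (Suc n) v x = x \<and> v \<otimes> b \<otimes> inv v = a \<and>
       (\<not> meager_in T (H n) \<longrightarrow> a \<in> H n \<and> b \<notin> H n)"
proof -
  define E where "E n x m a b v \<longleftrightarrow> v \<in> V m \<and> b \<in> carrier G \<and>
      generic_tuple (Suc (Suc n)) (x(Suc n := a)) \<and> generic_tuple (Suc (Suc n)) (x(Suc n := b)) \<and>
      diag_conj G (Suc n) v x = x \<and> v \<otimes> b \<otimes> inv v = a \<and>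
      (\<not> meager_in T (H n) \<longrightarrow> a \<in> H n \<and> b \<notin> H n)" for n x m a b v
  have "\<exists>p. generic_tuple (Suc n) x \<longrightarrow> E n x m (fst p) (fst (snd p)) (snd (snd p))" for n x m
  proof (cases "generic_tuple (Suc n) x")
    case True
    obtain a b v where "E n x m a b v"
      using exists_separating_generic_extensions[OF ample True H[of n] V[of m]] unfolding E_def
      by (metis (no_types, lifting))
    then show ?thesis by (intro exI[of _ "(a, b, v)"]) simp
  qed simp
  then obtain p where p: "\<And>n x m. generic_tuple (Suc n) x \<Longrightarrow>
      E n x m (fst (p n x m)) (fst (snd (p n x m))) (snd (snd (p n x m)))"
    by (metis (no_types, lifting))
  define a b v where "a n x m = fst (p n x m)" and "b n x m = fst (snd (p n x m))"
    and "v n x m = snd (snd (p n x m))" for n x m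
  have abv: "E n x m (a n x m) (b n x m) (v n x m)" if "generic_tuple (Suc n) x" for n x m
    using p[OF that] unfolding a_def b_def v_def .
  define step where "step = (\<lambda>(m, c) (n, x, h).
      if c then (Suc n, x(Suc n := b n x m), h \<otimes> v n x m) else (Suc n, x(Suc n := a n x m), h))"
  define P where "P = (\<lambda>(n, x, h). generic_tuple (Suc n) x \<and> h \<in> carrier G)"
  have P_step: "P (step mc s)" if "P s" for mc s
  proof -
    obtain m c n x h where eq: "mc = (m, c)" "s = (n, x, h)" by (metis prod_cases3 surj_pair)
    have x: "generic_tuple (Suc n) x" "h \<in> carrier G" using that unfolding P_def eq by simp_all
    have "v n x m \<in> carrier G" using abv[OF x(1)] openin_carrier[OF V(1)] unfolding E_def by blast
    then show ?thesis using abv[OF x(1), of m] x(2) unfolding P_def step_def eq E_def by simp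
  qed
  obtain x0 where x0: "generic_tuple (Suc 0) x0"
    using ample unfolding ample_generics_def generic_tuple_def by auto
  have P0: "P (0, x0, \<one>)" using x0 unfolding P_def by simp
  obtain S where S: "countable S" "(0, x0, \<one>) \<in> S" "\<forall>s\<in>S. P s"
    "\<forall>s\<in>S. \<forall>mc. step mc s \<in> S"
    by (rule countable_set_closed_under_countably_many_maps[of P _ step, OF P0 P_step])
  have "generic_tuple (Suc n) x \<and> h \<in> carrier G \<and> (\<forall>m. \<exists>a b v. v \<in> V m \<and> b \<in> carrier G \<and>
       (Suc n, x(Suc n := a), h) \<in> S \<and> (Suc n, x(Suc n := b), h \<otimes> v) \<in> S \<and>
       diag_conj G (Suc n) v x = x \<and> v \<otimes> b \<otimes> inv v = a \<and>
       (\<not> meager_in T (H n) \<longrightarrow> a \<in> H n \<and> b \<notin> H n))" if nxh: "(n, x, h) \<in> S" for n x h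
  proof (intro conjI allI)
    show x: "generic_tuple (Suc n) x" and "h \<in> carrier G"
      using bspec[OF S(3) nxh] unfolding P_def by simp_all
    fix m
    have "(Suc n, x(Suc n := a n x m), h) \<in> S" "(Suc n, x(Suc n := b n x m), h \<otimes> v n x m) \<in> S"
      using bspec[OF S(4) nxh, THEN spec, of "(m, False)"] bspec[OF S(4) nxh, THEN spec, of "(m, True)"]
      unfolding step_def by simp_all
    then show "\<exists>a b v. v \<in> V m \<and> b \<in> carrier G \<and>
       (Suc n, x(Suc n := a), h) \<in> S \<and> (Suc n, x(Suc n := b), h \<otimes> v) \<in> S \<and>
       diag_conj G (Suc n) v x = x \<and> v \<otimes> b \<otimes> inv v = a \<and>
       (\<not> meager_in T (H n) \<longrightarrow> a \<in> H n \<and> b \<notin> H n)"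
      using abv[OF x, of m] unfolding E_def
      by (intro exI[of _ "a n x m"] exI[of _ "b n x m"] exI[of _ "v n x m"]) simp
  qed
  then show ?thesis by (intro that[OF S(1,2)]) auto
qed

text \<open>
  The translation \<open>w\<close> is fixed before the branch through \<open>S\<close> is chosen. At stage \<open>n\<close> the radius of the ball
  around \<open>w h\<close> determines how small \<open>v\<close> must be, and the coset \<open>k n <# H n\<close> determines which of the
  two successors is taken.
\<close>
theorem (in polish_group) not_union_of_non_open_cosets:
  fixes k :: "nat \<Rightarrow> 'a" and H :: "nat \<Rightarrow> 'a set"
  assumes ample: "ample_generics G T"
    and k: "\<And>i. k i \<in> carrier G" and H: "\<And>i. subgroup (H i) G" "\<And>i. \<not> openin T (H i)"
  shows "carrier G \<noteq> (\<Union>i. k i <# H i)"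
proof
  assume cover: "carrier G = (\<Union>i. k i <# H i)"
  obtain M d where M: "Metric_space M d" "Metric_space.mcomplete M d" "T = Metric_space.mtopology M d"
    using completely_metrizable unfolding completely_metrizable_space_def by blast
  interpret Metric_space M d by fact
  have MG: "M = carrier G" using M(3) topspace_eq_carrier by simp
  define I where "I = {i. \<not> meager_in T (H i)}"
  define N where "N = (\<Union>i\<in>-I. k i <# H i)"
  have "meager_in T N" unfolding N_def
  proof (rule meager_in_UN)
    show "meager_in T (k i <# H i)" if "i \<in> -I" for i
      using that by (intro meager_in_left_coset k) (simp add: I_def)
  qed simp
  moreover have "topspace T - (topspace T - N) \<subseteq> N" by blast
  ultimately have "comeager_in T (topspace T - N)"
    using meager_in_subset unfolding comeager_in_def by auto
  then obtain D :: "nat \<Rightarrow> 'a set" where D: "\<And>i. openin T (D i)" "\<And>i. T closure_of (D i) = topspace T"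
    "(\<Inter>i. D i) \<subseteq> topspace T - N"
    using comeager_in_obtain_dense_open by metis

  define V where "V m = mball \<one> (inverse (real (Suc m)))" for m
  have V: "openin T (V m)" "\<one> \<in> V m" for m
  proof -
    show "openin T (V m)" unfolding V_def M(3) by (rule openin_mball)
    have "\<one> \<in> M" unfolding MG by simp
    then show "\<one> \<in> V m" unfolding V_def centre_in_mball_iff by simp
  qed
  obtain S and x0 :: "nat \<Rightarrow> 'a" where S0: "countable S" "(0, x0, \<one>) \<in> S"
    "\<forall>(n, x, h)\<in>S. generic_tuple (Suc n) x \<and> h \<in> carrier G"
    "\<forall>(n, x, h)\<in>S. \<forall>m. \<exists>a b v. v \<in> V m \<and> b \<in> carrier G \<and>
       (Suc n, x(Suc n := a), h) \<in> S \<and> (Suc n, x(Suc n := b), h \<otimes> v) \<in> S \<and>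
       diag_conj G (Suc n) v x = x \<and> v \<otimes> b \<otimes> inv v = a \<and>
       (\<not> meager_in T (H n) \<longrightarrow> a \<in> H n \<and> b \<notin> H n)"
    by (rule countable_generic_branching[OF ample H V(1) V(2)])
  note S = S0(1,2) bspec[OF S0(3), of "(n, x, h)" for n x h, unfolded prod.case]
    bspec[OF S0(4), of "(n, x, h)" for n x h, unfolded prod.case, THEN spec]
  let ?S = "(\<lambda>(n, x, h). h) ` S"
  have "comeager_in T (\<Inter>i. D i)"
  proof (rule comeager_in_INT)
    show "comeager_in T (D i)" for i by (rule comeager_in_dense_open[OF D(1,2)])
  qed simp_all
  moreover have "?S \<subseteq> carrier G" using S(3) by auto
  moreover have "countable ?S" using S(1) by simp
  ultimately obtain w where w: "w \<in> carrier G" "\<And>h. h \<in> ?S \<Longrightarrow> w \<otimes> h \<in> (\<Inter>i. D i)"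
    using countable_translate_into_comeager by metis
  have wD: "w \<otimes> h \<in> D i" if "(n, x, h) \<in> S" for n x h i
  proof -
    have "h \<in> ?S" using imageI[OF that, of "\<lambda>(n, x, h). h"] by simp
    then show ?thesis using w(2) by blast
  qed

  \<comment> \<open>The translate by \<open>w\<close> of a transporter, written as a preimage so that it is closed.\<close>
  define K where "K n x h = {z \<in> carrier G. inv w \<otimes> z \<in> transporter (Suc n) x h}" for n x h
  have advance: "\<exists>x' h' \<delta>. (Suc n, x', h') \<in> S \<and> 0 < \<delta> \<and> \<delta> \<le> \<epsilon> / 2 \<and>
      mcball (w \<otimes> h') \<delta> \<subseteq> mcball (w \<otimes> h) \<epsilon> \<inter> D n \<and> K (Suc n) x' h' \<subseteq> K n x h \<and>
      (n \<in> I \<longrightarrow> K (Suc n) x' h' \<inter> (k n <# H n) = {})"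
    if nxh: "(n, x, h) \<in> S" and \<epsilon>: "\<epsilon> > 0" for n x h \<epsilon>
  proof -
    have x: "x \<in> topspace (power_topology T (Suc n))" and h: "h \<in> carrier G"
      using S(3)[OF nxh] unfolding generic_tuple_def by simp_all
    define t where "t = w \<otimes> h"
    have t: "t \<in> M" "t \<in> carrier G" "t \<in> D n" using w(1) h wD[OF nxh] MG unfolding t_def by auto
    have "openin mtopology (D n)" using D(1)[of n] unfolding M(3) .
    then obtain r where r: "r > 0" "mcball t r \<subseteq> D n"
      using t(3) unfolding openin_mtopology_mcball by blast
    \<comment> \<open>The new centre is within \<open>\<delta>\<close> of \<open>t\<close>, so its ball of radius \<open>\<delta>\<close> is contained in the ball of
    radius \<open>2 * \<delta>\<close> around \<open>t\<close>.\<close>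
    define \<delta> where "\<delta> = min r \<epsilon> / 2"
    have \<delta>: "\<delta> > 0" "2 * \<delta> \<le> r" "2 * \<delta> \<le> \<epsilon>" using r(1) \<epsilon> unfolding \<delta>_def by auto
    let ?U = "{z \<in> carrier G. t \<otimes> z \<in> mball t \<delta>}"
    have "openin T (mball t \<delta>)" unfolding M(3) by simp
    then have "openin T ?U" using t(2) by (rule openin_left_mult_preimage)
    then have "openin mtopology ?U" unfolding M(3) .
    moreover have "\<one> \<in> ?U" using t(1,2) \<delta>(1) by simp
    ultimately obtain \<rho> where \<rho>: "\<rho> > 0" "mball \<one> \<rho> \<subseteq> ?U"
      unfolding openin_mtopology by blast
    obtain m where "inverse (real (Suc m)) < \<rho>" using reals_Archimedean[OF \<rho>(1)] by blast
    then have "mball \<one> (inverse (real (Suc m))) \<subseteq> mball \<one> \<rho>"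
      by (intro mball_subset_concentric) simp
    then have Vm: "V m \<subseteq> ?U" using \<rho>(2) unfolding V_def by (rule order_trans)
    obtain a b v where v: "v \<in> V m" and b: "b \<in> carrier G"
      and aS: "(Suc n, x(Suc n := a), h) \<in> S" and bS: "(Suc n, x(Suc n := b), h \<otimes> v) \<in> S"
      and vx: "diag_conj G (Suc n) v x = x" and vba: "v \<otimes> b \<otimes> inv v = a"
      and ab: "\<not> meager_in T (H n) \<longrightarrow> a \<in> H n \<and> b \<notin> H n"
      using S(4)[OF nxh, of m] by (elim exE conjE)
    have vG: "v \<in> carrier G" and tv: "t \<otimes> v \<in> mball t \<delta>" using v Vm by auto
    have ball: "mcball t' \<delta> \<subseteq> mcball t \<epsilon> \<inter> D n" if t': "t' \<in> mball t \<delta>" for t'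
    proof -
      have "d t' t + \<delta> \<le> 2 * \<delta>" using t' commute[of t' t] by simp
      then have "mcball t' \<delta> \<subseteq> mcball t (2 * \<delta>)" using t(1) by (rule mcball_subset)
      moreover have "mcball t (2 * \<delta>) \<subseteq> mcball t \<epsilon>" "mcball t (2 * \<delta>) \<subseteq> mcball t r"
        using \<delta>(2,3) mcball_subset_concentric by simp_all
      ultimately show ?thesis using r(2) by blast
    qed
    have Ka: "K (Suc n) (x(Suc n := a)) h \<subseteq> K n x h"
      using transporter_update_subset[of "Suc n" x a h] unfolding K_def by auto
    have Kb: "K (Suc n) (x(Suc n := b)) (h \<otimes> v) \<subseteq> K n x h"
      using transporter_update_subset[of "Suc n" x b "h \<otimes> v"]
        transporter_mult_stabilizer[OF x h vG vx] unfolding K_def by auto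
    have "n \<in> I \<longrightarrow> K (Suc n) (x(Suc n := a)) h \<inter> (k n <# H n) = {} \<or>
        K (Suc n) (x(Suc n := b)) (h \<otimes> v) \<inter> (k n <# H n) = {}"
    proof (rule ccontr)
      assume neg: "\<not> ?thesis"
      then obtain y z where yz: "y \<in> K (Suc n) (x(Suc n := a)) h" "y \<in> k n <# H n"
        "z \<in> K (Suc n) (x(Suc n := b)) (h \<otimes> v)" "z \<in> k n <# H n" by blast
      have "n \<in> I" using neg by simp
      then have abH: "a \<in> H n" "b \<notin> H n" using ab unfolding I_def by simp_all
      have "w \<otimes> (inv w \<otimes> y) = y" "w \<otimes> (inv w \<otimes> z) = z"
        using yz(1,3) w(1) unfolding K_def by (simp_all add: m_assoc[symmetric])
      then have wy: "w \<otimes> (inv w \<otimes> y) \<in> k n <# H n" and wz: "w \<otimes> (inv w \<otimes> z) \<in> k n <# H n"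
        using yz(2,4) by simp_all
      have "inv w \<otimes> y \<in> transporter (Suc (Suc n)) (x(Suc n := a)) h"
        "inv w \<otimes> z \<in> transporter (Suc (Suc n)) (x(Suc n := b)) (h \<otimes> v)"
        using yz(1,3) unfolding K_def by simp_all
      from transporters_not_both_meet_coset[OF H(1) abH b h vG w(1) k vba this(1) wy this(2) wz]
      show False .
    qed
    then consider "n \<in> I \<longrightarrow> K (Suc n) (x(Suc n := a)) h \<inter> (k n <# H n) = {}"
      | "n \<in> I \<longrightarrow> K (Suc n) (x(Suc n := b)) (h \<otimes> v) \<inter> (k n <# H n) = {}" by argo
    then show ?thesis
    proof cases
      case 1
      have "mcball (w \<otimes> h) \<delta> \<subseteq> mcball (w \<otimes> h) \<epsilon> \<inter> D n"
        using ball[of t] t(1) \<delta>(1) unfolding t_def by blast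
      then show ?thesis using aS \<delta> Ka 1
        by (intro exI[of _ "x(Suc n := a)"] exI[of _ h] exI[of _ \<delta>]) simp
    next
      case 2
      have "w \<otimes> (h \<otimes> v) = t \<otimes> v" unfolding t_def using w(1) h vG by (simp add: m_assoc)
      then have "mcball (w \<otimes> (h \<otimes> v)) \<delta> \<subseteq> mcball (w \<otimes> h) \<epsilon> \<inter> D n"
        using ball[OF tv] unfolding t_def by simp
      then show ?thesis using bS \<delta> Kb 2
        by (intro exI[of _ "x(Suc n := b)"] exI[of _ "h \<otimes> v"] exI[of _ \<delta>]) simp
    qed
  qed

  \<comment> \<open>\<open>Q\<close> describes the states with their radii, \<open>R\<close> the passage from one stage to the next.\<close>
  define Q where "Q n s \<longleftrightarrow> (case s of (x, h, \<epsilon>) \<Rightarrow> (n, x, h) \<in> S \<and> 0 < \<epsilon> \<and> \<epsilon> \<le> (1 / 2) ^ n)"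
    for n :: nat and s :: "(nat \<Rightarrow> 'a) \<times> 'a \<times> real"
  define R where "R n s s' \<longleftrightarrow> (case s of (x, h, \<epsilon>) \<Rightarrow> case s' of (x', h', \<epsilon>') \<Rightarrow>
      mcball (w \<otimes> h') \<epsilon>' \<subseteq> mcball (w \<otimes> h) \<epsilon> \<inter> D n \<and> K (Suc n) x' h' \<subseteq> K n x h \<and>
      (n \<in> I \<longrightarrow> K (Suc n) x' h' \<inter> (k n <# H n) = {}))"
    for n :: nat and s s' :: "(nat \<Rightarrow> 'a) \<times> 'a \<times> real"
  have "\<exists>f. \<forall>n. Q n (f n) \<and> R n (f n) (f (Suc n))"
  proof (rule dependent_nat_choice)
    show "\<exists>s. Q 0 s"
      unfolding Q_def using S(2) by (intro exI[of _ "(x0, \<one>, 1)"]) simp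
    fix s n assume s: "Q n s"
    obtain x h \<epsilon> where s_eq: "s = (x, h, \<epsilon>)" by (rule prod_cases3)
    have nxh: "(n, x, h) \<in> S" and \<epsilon>: "\<epsilon> > 0" "\<epsilon> \<le> (1 / 2) ^ n"
      using s unfolding Q_def s_eq by simp_all
    obtain x' h' \<delta> where "(Suc n, x', h') \<in> S" "0 < \<delta>" "\<delta> \<le> \<epsilon> / 2"
      "mcball (w \<otimes> h') \<delta> \<subseteq> mcball (w \<otimes> h) \<epsilon> \<inter> D n" "K (Suc n) x' h' \<subseteq> K n x h"
      "n \<in> I \<longrightarrow> K (Suc n) x' h' \<inter> (k n <# H n) = {}"
      using advance[OF nxh \<epsilon>(1)] by (elim exE conjE)
    then have "Q (Suc n) (x', h', \<delta>)" "R n s (x', h', \<delta>)"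
      using \<epsilon>(2) unfolding Q_def R_def s_eq by simp_all
    then show "\<exists>s'. Q (Suc n) s' \<and> R n s s'" by (intro exI conjI)
  qed
  then obtain f where f: "\<And>n. Q n (f n)" "\<And>n. R n (f n) (f (Suc n))" by blast
  define x h \<epsilon> where "x n = fst (f n)" and "h n = fst (snd (f n))" and "\<epsilon> n = snd (snd (f n))" for n
  have f_eq: "f n = (x n, h n, \<epsilon> n)" for n unfolding x_def h_def \<epsilon>_def by simp
  have Qn: "(n, x n, h n) \<in> S" "\<epsilon> n > 0" "\<epsilon> n \<le> (1 / 2) ^ n" for n
    using f(1)[of n] unfolding Q_def f_eq by simp_all
  have Rn: "mcball (w \<otimes> h (Suc n)) (\<epsilon> (Suc n)) \<subseteq> mcball (w \<otimes> h n) (\<epsilon> n) \<inter> D n"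
    "K (Suc n) (x (Suc n)) (h (Suc n)) \<subseteq> K n (x n) (h n)"
    "n \<in> I \<Longrightarrow> K (Suc n) (x (Suc n)) (h (Suc n)) \<inter> (k n <# H n) = {}" for n
    using f(2)[of n] unfolding R_def f_eq by simp_all
  have xh: "x n \<in> topspace (power_topology T (Suc n))" "h n \<in> carrier G" for n
    using S(3)[OF Qn(1)[of n]] unfolding generic_tuple_def by simp_all
  define C where "C n = mcball (w \<otimes> h n) (\<epsilon> n) \<inter> K n (x n) (h n)" for n
  have "closedin mtopology (C n)" for n
  proof -
    have "closedin T (K n (x n) (h n))" unfolding K_def
      using closedin_continuous_map_preimage[OF homeomorphic_imp_continuous_map[OF
            homeomorphic_map_left_mult[OF inv_closed[OF w(1)]]] closedin_transporter[OF xh]]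
      unfolding topspace_eq_carrier .
    then have "closedin mtopology (K n (x n) (h n))" unfolding M(3) .
    then show ?thesis unfolding C_def by (intro closedin_Int) simp_all
  qed
  moreover have "C n \<noteq> {}" for n
  proof -
    have "inv w \<otimes> (w \<otimes> h n) = h n" using w(1) xh(2) by (simp add: m_assoc[symmetric])
    then have "w \<otimes> h n \<in> K n (x n) (h n)"
      unfolding K_def transporter_def using w(1) xh(2) by simp
    moreover have "w \<otimes> h n \<in> M" using w(1) xh(2) unfolding MG by simp
    then have "w \<otimes> h n \<in> mcball (w \<otimes> h n) (\<epsilon> n)" using Qn(2)[of n] by simp
    ultimately show ?thesis unfolding C_def by blast
  qed
  moreover have "decseq C"
  proof (rule decseq_SucI)
    show "C (Suc n) \<subseteq> C n" for n using Rn(1,2)[of n] unfolding C_def by blast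
  qed
  moreover have "\<exists>n a. C n \<subseteq> mcball a e" if "e > 0" for e
  proof -
    obtain n where "(1 / 2 :: real) ^ n < e" using real_arch_pow_inv[OF \<open>e > 0\<close>, of "1/2"] by auto
    then have "\<epsilon> n \<le> e" using Qn(3)[of n] by linarith
    then have "mcball (w \<otimes> h n) (\<epsilon> n) \<subseteq> mcball (w \<otimes> h n) e" by (rule mcball_subset_concentric)
    then show ?thesis unfolding C_def by blast
  qed
  ultimately have "\<Inter> (range C) \<noteq> {}" using M(2) unfolding mcomplete_nest by simp
  then obtain z where z: "\<And>n. z \<in> C n" by auto
  have "z \<in> D n" for n using z[of "Suc n"] Rn(1)[of n] unfolding C_def by auto
  then have "z \<in> topspace T - N" using D(3) by auto
  then have "z \<in> carrier G" "z \<notin> N" unfolding topspace_eq_carrier by simp_all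
  then obtain n where n: "z \<in> k n <# H n" "n \<in> I" using cover unfolding N_def by auto
  then show False using z[of "Suc n"] Rn(3)[OF n(2)] unfolding C_def by auto
qed

theorem theorem1p7:
  fixes G :: "('a, 'b) monoid_scheme" and T :: "'a topology"
  assumes "polish_group G T"
    and "ample_generics G T"
  shows "(\<nexists>\<H>. countable \<H> \<and> (\<forall>H\<in>\<H>. subgroup H G \<and> \<not> openin T H) \<and>
            carrier G = \<Union>\<H>) \<and>
         (\<nexists>(g :: nat \<Rightarrow> 'a) H.
            (\<forall>i. g i \<in> carrier G \<and> subgroup (H i) G \<and> \<not> openin T (H i)) \<and>
            carrier G = (\<Union>i. g i <#\<^bsub>G\<^esub> H i))"
proof -
  interpret polish_group G T by fact
  have union: False if \<H>: "countable \<H>" "\<forall>H\<in>\<H>. subgroup H G \<and> \<not> openin T H"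
    "carrier G = \<Union>\<H>" for \<H>
  proof -
    have "\<H> \<noteq> {}" using \<H>(3) one_closed by auto
    then have range: "range (from_nat_into \<H>) = \<H>" using \<H>(1) by (rule range_from_nat_into)
    have mem: "from_nat_into \<H> i \<in> \<H>" for i using rangeI[of "from_nat_into \<H>" i] unfolding range .
    then have H: "subgroup (from_nat_into \<H> i) G" "\<not> openin T (from_nat_into \<H> i)" for i
      using \<H>(2) by simp_all
    have "\<one>\<^bsub>G\<^esub> <#\<^bsub>G\<^esub> from_nat_into \<H> i = from_nat_into \<H> i" for i
      using subgroup.subset[OF H(1)] by (rule lcos_mult_one)
    then have "carrier G = (\<Union>i. \<one>\<^bsub>G\<^esub> <#\<^bsub>G\<^esub> from_nat_into \<H> i)"
      using range \<H>(3) by simp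
    then show False
      using not_union_of_non_open_cosets[OF assms(2) one_closed H] by (rule notE[rotated])
  qed
  show ?thesis
  proof (intro conjI notI; elim exE conjE)
    show False if "countable \<H>" "\<forall>H\<in>\<H>. subgroup H G \<and> \<not> openin T H" "carrier G = \<Union>\<H>" for \<H>
      using that by (rule union)
  next
    fix g :: "nat \<Rightarrow> 'a" and H
    assume gH: "\<forall>i. g i \<in> carrier G \<and> subgroup (H i) G \<and> \<not> openin T (H i)"
      and "carrier G = (\<Union>i. g i <#\<^bsub>G\<^esub> H i)"
    moreover have "carrier G \<noteq> (\<Union>i. g i <#\<^bsub>G\<^esub> H i)"
      by (rule not_union_of_non_open_cosets[OF assms(2)]) (use gH in simp_all)
    ultimately show False by simp
  qed
qed

end
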